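(* Consider the semidiscrete system $\frac{dV}{dt}(t)=(A+B)V(t)+g(t)$ defined in the context (uniform grid, Dirichlet boundary conditions) and the Crank--Nicolson scheme $$(I-\tfrac12\Delta tA)V^{n+1}=(I+\tfrac12\Delta tA)V^n+\tfrac12\Delta t(BV^n+BV^{n+1})+\tfrac12\Delta t(g_n+g_{n+1}),\qquad g_n=g(t_n),\ t_n=n\Delta t,$$ with $V^0=V(0)=v_{\Delta x,\Delta y}(0)$. Let $T>0$ and $$\widehat C=(|w_{-1}|-10w_2)(\alpha+\beta)-(r+\lambda)+\lambda\sqrt{L_y\|f\|_\infty}.$$ Assume: (a) (smoothness) $t\mapsto v_{\Delta x,\Delta y}(t)$ is three times continuously differentiable on $[0,T]$ with $\|\frac{d^3}{dt^3}v_{\Delta x,\Delta y}(t)\|_2$ bounded uniformly in $t\in[0,T]$, $\Delta x$, $\Delta y$; (b) (second-order consistency of the semidiscretisation) there is a constant $C_1>0$, independent of $t,\Delta x,\Delta y$, such that the local spatial error $\delta(t)=\frac{dv_{\Delta x,\Delta y}}{dt}(t)-(A+B)v_{\Delta x,\Delta y}(t)-g(t)$ satisfies $\|\delta(t)\|_2\le C_1(\Delta x^2+\Delta y^2)$ for $t\in[0,T]$. Then the Crank--Nicolson scheme is convergent in the $\ell_2$-norm; moreover, there is a constant $C>0$, independent of $n,\Delta t,\Delta x,\Delta y$, such that the global error $\hat\epsilon_n=v_{\Delta x,\Delta y}(t_n)-V^n$ satisfies $$\|\hat\epsilon_n\|_2\le C(\Delta t^2+\Delta x^2+\Delta y^2)\quad\text{whenever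 } n=0,1,2,\dots\text{ with } n\Delta t\le T\text{ and }\widehat C\Delta t\le1.$$
   Context: Parameters: $\alpha,\beta,\sigma,\lambda,\Delta t>0$, $\mu,r,K\in\mathbb R$; $f$ is a bounded probability density on $\mathbb R$, $\|f\|_\infty=\sup_{\xi}|f(\xi)|<\infty$, $L_y=y_{\max}-y_{\min}$. The real weights satisfy $\sum_{k=-1}^2w_k=0$, $\sum_{k=-1}^2kw_k=1$, $\sum_{k=-1}^2k^2w_k=0$, $w_2\le0$. $v(x,y,t)$ denotes the exact solution of the PIDE $\partial_tv=\frac{\sigma^2}{2}\partial_{xx}v+\alpha(\mu-x)\partial_xv-\beta y\,\partial_yv-(r+\lambda)v+\lambda\int_{\mathbb R}v(x,y+\xi,t)f(\xi)\,d\xi$, $t>0$, with $v(x,y,0)=\max(x+y-K,0)$ and Dirichlet boundary conditions $v(x_{\min},y,t)=u_1(y,t)$, $v(x_{\max},y,t)=u_2(y,t)$, $v(x,y_{\min},t)=v_1(x,t)$, $v(x,y_{\max},t)=v_2(x,t)$ for given functions $u_1,u_2,v_1,v_2$. The domain $[x_{\min},x_{\max}]\times[y_{\min},y_{\max}]$ is fixed. Grid: $x_{\min}=x_{-1}<x_0<\dots<x_{m_1}<x_{m_1+1}=x_{\max}$ and $y_{\min}=y_{-1}<y_0<\dots<y_{m_2}<y_{m_2+1}=y_{\max}$ are uniform meshes with widths $\Delta x,\Delta y$. The unknowns are $V=(V_{i,j})_{0\le i\le m_1,0\le j\le m_2}$ (entry $i(m_2+1)+j$), and $v_{\Delta x,\Delta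 y}(t)$ is the vector with entries $v(x_i,y_j,t)$. $I$ is the identity. Put $a_i=\alpha(\mu-x_i)$, $b_j=-\beta y_j$, $c^+=\max(c,0)$, $c^-=\min(c,0)$. Standing assumption: $a(x)=\alpha(\mu-x)$ and $b(y)=-\beta y$ change sign within the domain, being positive near $x_{\min},y_{\min}$ and negative near $x_{\max},y_{\max}$: $a_0>0>a_{m_1}$, $b_0>0>b_{m_2}$ (so no stencil below extends beyond the boundary nodes). The matrices $A,B$ are obtained from the following formulas by setting all boundary values (indices $-1,m_1+1$ in $i$; $-1,m_2+1$ in $j$) equal to zero: $(AV)_{i,j}=\frac{\sigma^2}{2}\frac{V_{i-1,j}-2V_{i,j}+V_{i+1,j}}{\Delta x^2}-(r+\lambda)V_{i,j}+a_i^+\frac{w_2V_{i+2,j}+w_1V_{i+1,j}+w_0V_{i,j}+w_{-1}V_{i-1,j}}{\Delta x}+a_i^-\frac{-w_{-1}V_{i+1,j}-w_0V_{i,j}-w_1V_{i-1,j}-w_2V_{i-2,j}}{\Delta x}+b_j^+\frac{w_2V_{i,j+2}+w_1V_{i,j+1}+w_0V_{i,j}+w_{-1}V_{i,j-1}}{\Delta y}+b_j^-\frac{-w_{-1}V_{i,j+1}-w_0V_{i,j}-w_1V_{i,j-1}-w_2V_{i,j-2}}{\Delta y},$ $(BV)_{i,j}=\lambda\sum_{\ell=-1}^{m_2}\int_{y_\ell}^{y_{\ell+1}}\Big(\frac{y_{\ell+1}-\xi}{\Delta y}V_{i,\ell}+\frac{\xi-y_\ell}{\Delta y}V_{i,\ell+1}\Big)f(\xi-y_j)\,d\xi.$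 The vector $g(t)$ collects the contributions of the boundary values in these formulas when the boundary entries are set to the Dirichlet data at time $t$. The norm is $\|V\|_2=\sqrt{\langle V,V\rangle}$ with $\langle U,V\rangle=\Delta x\Delta y\sum_kU_kV_k$. *)

theory Defs
  imports "HOL-Analysis.Analysis" "Jordan_Normal_Form.Matrix"
begin

text \<open>Data of the initial-boundary value problem on the fixed rectangle
  \<open>[xmin, xmax] \<times> [ymin, ymax]\<close>. The field \<open>wt\<close> holds the finite-difference weights, of which
  only \<open>wt (-1), \<dots>, wt 2\<close> matter; \<open>bd_xmin\<close>, \<open>bd_xmax\<close> take \<open>(y, t)\<close> and
  \<open>bd_ymin\<close>, \<open>bd_ymax\<close> take \<open>(x, t)\<close>.\<close>

record problem =
  alpha :: real
  beta :: real
  vol :: real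
  lam :: real
  mu :: real
  rate :: real
  strike :: real
  dens :: "real \<Rightarrow> real"
  xmin :: real
  xmax :: real
  ymin :: real
  ymax :: real
  wt :: "int \<Rightarrow> real"
  bd_xmin :: "real \<Rightarrow> real \<Rightarrow> real"
  bd_xmax :: "real \<Rightarrow> real \<Rightarrow> real"
  bd_ymin :: "real \<Rightarrow> real \<Rightarrow> real"
  bd_ymax :: "real \<Rightarrow> real \<Rightarrow> real"

definition bounded_prob_density :: "(real \<Rightarrow> real) \<Rightarrow> bool" where
  "bounded_prob_density f \<longleftrightarrow>
     f \<in> borel_measurable borel \<and> (\<forall>s. 0 \<le> f s) \<and> has_bochner_integral lborel f 1 \<and>
     bdd_above (range (\<lambda>s. \<bar>f s\<bar>))"

definition sup_norm :: "(real \<Rightarrow> real) \<Rightarrow> real" where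
  "sup_norm f = (SUP s. \<bar>f s\<bar>)"

definition weight_conditions :: "(int \<Rightarrow> real) \<Rightarrow> bool" where
  "weight_conditions w \<longleftrightarrow>
     (\<Sum>k=-1..2. w k) = 0 \<and> (\<Sum>k=-1..2. of_int k * w k) = 1 \<and>
     (\<Sum>k=-1..2. (of_int k)\<^sup>2 * w k) = 0 \<and> w 2 \<le> 0"

text \<open>The solution is defined for all real arguments since the jump integral reaches beyond the
  rectangle; what it is outside the rectangle is not prescribed. The boundary conditions are
  imposed for \<open>t > 0\<close> only, so boundary data need not be compatible with the initial data.\<close>

definition exact_solution :: "problem \<Rightarrow> (real \<Rightarrow> real \<Rightarrow> real \<Rightarrow> real) \<Rightarrow> bool" where
  "exact_solution P v \<longleftrightarrow>
     (\<exists>vt vx vxx vy. \<forall>x\<in>{xmin P<..<xmax P}. \<forall>y\<in>{ymin P<..<ymax P}. \<forall>t>0.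
        ((\<lambda>s. v x y s) has_real_derivative vt x y t) (at t) \<and>
        ((\<lambda>z. v z y t) has_real_derivative vx x y t) (at x) \<and>
        ((\<lambda>z. vx z y t) has_real_derivative vxx x y t) (at x) \<and>
        ((\<lambda>z. v x z t) has_real_derivative vy x y t) (at y) \<and>
        integrable lborel (\<lambda>s. v x (y + s) t * dens P s) \<and>
        vt x y t =
          (vol P)\<^sup>2 / 2 * vxx x y t + alpha P * (mu P - x) * vx x y t
          - beta P * y * vy x y t - (rate P + lam P) * v x y t
          + lam P * (LBINT s. v x (y + s) t * dens P s)) \<and>
     (\<forall>x\<in>{xmin P..xmax P}. \<forall>y\<in>{ymin P..ymax P}. v x y 0 = max (x + y - strike P) 0) \<and>
     (\<forall>y\<in>{ymin P..ymax P}. \<forall>t>0.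
        v (xmin P) y t = bd_xmin P y t \<and> v (xmax P) y t = bd_xmax P y t) \<and>
     (\<forall>x\<in>{xmin P..xmax P}. \<forall>t>0.
        v x (ymin P) t = bd_ymin P x t \<and> v x (ymax P) t = bd_ymax P x t)"

text \<open>Nodes are indexed by integers, \<open>-1\<close> and \<open>m + 1\<close> being the boundary indices.\<close>

definition dx :: "problem \<Rightarrow> nat \<Rightarrow> real" where
  "dx P m1 = (xmax P - xmin P) / (real m1 + 2)"

definition dy :: "problem \<Rightarrow> nat \<Rightarrow> real" where
  "dy P m2 = (ymax P - ymin P) / (real m2 + 2)"

definition xnode :: "problem \<Rightarrow> nat \<Rightarrow> int \<Rightarrow> real" where
  "xnode P m1 i = xmin P + (of_int i + 1) * dx P m1"

definition ynode :: "problem \<Rightarrow> nat \<Rightarrow> int \<Rightarrow> real" where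
  "ynode P m2 j = ymin P + (of_int j + 1) * dy P m2"

definition acoef :: "problem \<Rightarrow> nat \<Rightarrow> int \<Rightarrow> real" where
  "acoef P m1 i = alpha P * (mu P - xnode P m1 i)"

definition bcoef :: "problem \<Rightarrow> nat \<Rightarrow> int \<Rightarrow> real" where
  "bcoef P m2 j = - beta P * ynode P m2 j"

definition admissible_grid :: "problem \<Rightarrow> nat \<Rightarrow> nat \<Rightarrow> bool" where
  "admissible_grid P m1 m2 \<longleftrightarrow>
     acoef P m1 0 > 0 \<and> 0 > acoef P m1 (int m1) \<and>
     bcoef P m2 0 > 0 \<and> 0 > bcoef P m2 (int m2)"

abbreviation pos_part :: "real \<Rightarrow> real" where
  "pos_part c \<equiv> max c 0"

abbreviation neg_part :: "real \<Rightarrow> real" where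
  "neg_part c \<equiv> min c 0"

text \<open>The two formulas below act on grid functions that carry boundary values.\<close>

definition A_formula :: "problem \<Rightarrow> nat \<Rightarrow> nat \<Rightarrow> (int \<Rightarrow> int \<Rightarrow> real) \<Rightarrow> int \<Rightarrow> int \<Rightarrow> real" where
  "A_formula P m1 m2 V i j =
     (vol P)\<^sup>2 / 2 * ((V (i - 1) j - 2 * V i j + V (i + 1) j) / (dx P m1)\<^sup>2)
     - (rate P + lam P) * V i j
     + pos_part (acoef P m1 i) *
         ((wt P 2 * V (i + 2) j + wt P 1 * V (i + 1) j + wt P 0 * V i j
           + wt P (-1) * V (i - 1) j) / dx P m1)
     + neg_part (acoef P m1 i) *
         ((- wt P (-1) * V (i + 1) j - wt P 0 * V i j - wt P 1 * V (i - 1) j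
           - wt P 2 * V (i - 2) j) / dx P m1)
     + pos_part (bcoef P m2 j) *
         ((wt P 2 * V i (j + 2) + wt P 1 * V i (j + 1) + wt P 0 * V i j
           + wt P (-1) * V i (j - 1)) / dy P m2)
     + neg_part (bcoef P m2 j) *
         ((- wt P (-1) * V i (j + 1) - wt P 0 * V i j - wt P 1 * V i (j - 1)
           - wt P 2 * V i (j - 2)) / dy P m2)"

definition B_formula :: "problem \<Rightarrow> nat \<Rightarrow> nat \<Rightarrow> (int \<Rightarrow> int \<Rightarrow> real) \<Rightarrow> int \<Rightarrow> int \<Rightarrow> real" where
  "B_formula P m1 m2 V i j =
     lam P * (\<Sum>l=-1..int m2.
       LBINT s:{ynode P m2 l..ynode P m2 (l + 1)}.
         ((ynode P m2 (l + 1) - s) / dy P m2 * V i l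
          + (s - ynode P m2 l) / dy P m2 * V i (l + 1)) * dens P (s - ynode P m2 j))"

text \<open>Unknowns are numbered row by row: node \<open>(i, j)\<close> is entry \<open>i * (m2 + 1) + j\<close>.\<close>

definition gdim :: "nat \<Rightarrow> nat \<Rightarrow> nat" where
  "gdim m1 m2 = (m1 + 1) * (m2 + 1)"

definition gvec :: "nat \<Rightarrow> nat \<Rightarrow> (int \<Rightarrow> int \<Rightarrow> real) \<Rightarrow> real vec" where
  "gvec m1 m2 F =
     vec (gdim m1 m2) (\<lambda>k. F (int (k div (m2 + 1))) (int (k mod (m2 + 1))))"

definition zero_ext :: "nat \<Rightarrow> nat \<Rightarrow> real vec \<Rightarrow> int \<Rightarrow> int \<Rightarrow> real" where
  "zero_ext m1 m2 V i j =
     (if 0 \<le> i \<and> i \<le> int m1 \<and> 0 \<le> j \<and> j \<le> int m2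
      then vec_index V (nat i * (m2 + 1) + nat j) else 0)"

text \<open>Matrix of the linear map that a formula induces when all boundary values are zero;
  column \<open>q\<close> is the image of the \<open>q\<close>-th unit vector.\<close>

definition formula_mat ::
  "nat \<Rightarrow> nat \<Rightarrow> ((int \<Rightarrow> int \<Rightarrow> real) \<Rightarrow> int \<Rightarrow> int \<Rightarrow> real) \<Rightarrow> real mat" where
  "formula_mat m1 m2 S =
     mat (gdim m1 m2) (gdim m1 m2)
       (\<lambda>(p, q). vec_index (gvec m1 m2 (S (zero_ext m1 m2 (unit_vec (gdim m1 m2) q)))) p)"

definition A_mat :: "problem \<Rightarrow> nat \<Rightarrow> nat \<Rightarrow> real mat" where
  "A_mat P m1 m2 = formula_mat m1 m2 (A_formula P m1 m2)"

definition B_mat :: "problem \<Rightarrow> nat \<Rightarrow> nat \<Rightarrow> real mat" where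
  "B_mat P m1 m2 = formula_mat m1 m2 (B_formula P m1 m2)"

text \<open>The grid function that equals the Dirichlet data at the boundary nodes and vanishes in the
  interior. Its values at the four corners are never used.\<close>

definition boundary_ext :: "problem \<Rightarrow> nat \<Rightarrow> nat \<Rightarrow> real \<Rightarrow> int \<Rightarrow> int \<Rightarrow> real" where
  "boundary_ext P m1 m2 t i j =
     (if i = -1 then bd_xmin P (ynode P m2 j) t
      else if i = int m1 + 1 then bd_xmax P (ynode P m2 j) t
      else if j = -1 then bd_ymin P (xnode P m1 i) t
      else if j = int m2 + 1 then bd_ymax P (xnode P m1 i) t
      else 0)"

definition g_vec :: "problem \<Rightarrow> nat \<Rightarrow> nat \<Rightarrow> real \<Rightarrow> real vec" where
  "g_vec P m1 m2 t =
     gvec m1 m2 (A_formula P m1 m2 (boundary_ext P m1 m2 t))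
     + gvec m1 m2 (B_formula P m1 m2 (boundary_ext P m1 m2 t))"

definition exact_vec ::
  "problem \<Rightarrow> (real \<Rightarrow> real \<Rightarrow> real \<Rightarrow> real) \<Rightarrow> nat \<Rightarrow> nat \<Rightarrow> real \<Rightarrow> real vec" where
  "exact_vec P v m1 m2 t = gvec m1 m2 (\<lambda>i j. v (xnode P m1 i) (ynode P m2 j) t)"

definition grid_inner :: "problem \<Rightarrow> nat \<Rightarrow> nat \<Rightarrow> real vec \<Rightarrow> real vec \<Rightarrow> real" where
  "grid_inner P m1 m2 U V =
     dx P m1 * dy P m2 * (\<Sum>k<gdim m1 m2. vec_index U k * vec_index V k)"

definition norm2 :: "problem \<Rightarrow> nat \<Rightarrow> nat \<Rightarrow> real vec \<Rightarrow> real" where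
  "norm2 P m1 m2 V = sqrt (grid_inner P m1 m2 V V)"

text \<open>Entrywise derivative of a vector-valued function on \<open>[0, T]\<close>, one-sided at the end points.\<close>

definition ddt :: "real \<Rightarrow> (real \<Rightarrow> real vec) \<Rightarrow> real \<Rightarrow> real vec" where
  "ddt T u t =
     vec (dim_vec (u t)) (\<lambda>k. vector_derivative (\<lambda>s. vec_index (u s) k) (at t within {0..T}))"

definition Ck_vec :: "nat \<Rightarrow> nat \<Rightarrow> real \<Rightarrow> (real \<Rightarrow> real vec) \<Rightarrow> bool" where
  "Ck_vec N q T u \<longleftrightarrow>
     (\<forall>k<N. (\<forall>p<q. (\<lambda>t. vec_index ((ddt T ^^ p) u t) k) differentiable_on {0..T}) \<and>
            continuous_on {0..T} (\<lambda>t. vec_index ((ddt T ^^ q) u t) k))"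

definition spatial_error ::
  "problem \<Rightarrow> (real \<Rightarrow> real \<Rightarrow> real \<Rightarrow> real) \<Rightarrow> real \<Rightarrow> nat \<Rightarrow> nat \<Rightarrow> real \<Rightarrow> real vec" where
  "spatial_error P v T m1 m2 t =
     ddt T (exact_vec P v m1 m2) t
     - (A_mat P m1 m2 + B_mat P m1 m2) *\<^sub>v exact_vec P v m1 m2 t
     - g_vec P m1 m2 t"

definition crank_nicolson ::
  "problem \<Rightarrow> (real \<Rightarrow> real \<Rightarrow> real \<Rightarrow> real) \<Rightarrow> nat \<Rightarrow> nat \<Rightarrow> real \<Rightarrow> (nat \<Rightarrow> real vec) \<Rightarrow> bool" where
  "crank_nicolson P v m1 m2 dt V \<longleftrightarrow>
     (let N = gdim m1 m2; A = A_mat P m1 m2; B = B_mat P m1 m2;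
          g = (\<lambda>n. g_vec P m1 m2 (real n * dt))
      in V 0 = exact_vec P v m1 m2 0 \<and>
         (\<forall>n. V n \<in> carrier_vec N) \<and>
         (\<forall>n. (1\<^sub>m N - (dt / 2) \<cdot>\<^sub>m A) *\<^sub>v V (Suc n) =
              (1\<^sub>m N + (dt / 2) \<cdot>\<^sub>m A) *\<^sub>v V n
              + (dt / 2) \<cdot>\<^sub>v (B *\<^sub>v V n + B *\<^sub>v V (Suc n))
              + (dt / 2) \<cdot>\<^sub>v (g n + g (Suc n))))"

definition global_error ::
  "problem \<Rightarrow> (real \<Rightarrow> real \<Rightarrow> real \<Rightarrow> real) \<Rightarrow> nat \<Rightarrow> nat \<Rightarrow> real \<Rightarrow> (nat \<Rightarrow> real vec) \<Rightarrow> nat \<Rightarrow> real vec"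
where
  "global_error P v m1 m2 dt V n = exact_vec P v m1 m2 (real n * dt) - V n"

definition C_hat :: "problem \<Rightarrow> real" where
  "C_hat P = (\<bar>wt P (-1)\<bar> - 10 * wt P 2) * (alpha P + beta P) - (rate P + lam P)
     + lam P * sqrt ((ymax P - ymin P) * sup_norm (dens P))"

text \<open>Convergence on \<open>[0, T]\<close>: the global error tends to zero, uniformly in the time level, as
  all mesh widths tend to zero independently of each other.\<close>

definition convergent_CN :: "problem \<Rightarrow> (real \<Rightarrow> real \<Rightarrow> real \<Rightarrow> real) \<Rightarrow> real \<Rightarrow> bool" where
  "convergent_CN P v T \<longleftrightarrow>
     (\<forall>e>0. \<exists>d>0. \<forall>m1 m2 dt V n.
        admissible_grid P m1 m2 \<and> dx P m1 < d \<and> dy P m2 < d \<and> 0 < dt \<and> dt < d \<and>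
        crank_nicolson P v m1 m2 dt V \<and> real n * dt \<le> T
        \<longrightarrow> norm2 P m1 m2 (global_error P v m1 m2 dt V n) < e)"

end

theory Submission
  imports Defs
begin

text \<open>The discrete operator satisfies the one-sided estimate
  \<open>\<langle>(A + B)V, V\<rangle> \<le> C_hat \<parallel>V\<parallel>\<^sup>2\<close>: diffusion is negative semidefinite, the weights split into the
  central difference plus \<open>w\<^sub>2\<close> times an upwind third difference, for which summation by parts
  leaves only terms with the increments of the drift, and \<open>B\<close> is bounded by Jensen's inequality for
  the sub-probability weights of the interpolated jump kernel. Testing the error equation with
  \<open>\<epsilon>\<^sub>n\<^sub>+\<^sub>1 + \<epsilon>\<^sub>n\<close> turns \<open>\<parallel>\<epsilon>\<^sub>n\<^sub>+\<^sub>1\<parallel>\<^sup>2 - \<parallel>\<epsilon>\<^sub>n\<parallel>\<^sup>2\<close> into this quadratic form plus the truncation error; after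
  division by \<open>\<parallel>\<epsilon>\<^sub>n\<^sub>+\<^sub>1\<parallel> + \<parallel>\<epsilon>\<^sub>n\<parallel>\<close> a discrete Gronwall argument applies, and no estimate of a resolvent
  is needed.\<close>

section \<open>Finite differences on the line\<close>

text \<open>The shifted window \<open>{c + k..d + k}\<close> still contains the support, so no term
  is lost. For grid functions extended by zero, telescoping sums therefore cancel without boundary
  terms.\<close>

lemma sum_shift_supported:
  fixes G :: "int \<Rightarrow> 'a::comm_monoid_add"
  assumes "\<And>i. i \<notin> {a..b} \<Longrightarrow> G i = 0" and "c + k \<le> a" and "b \<le> d + k"
  shows "(\<Sum>i=c..d. G (i + k)) = (\<Sum>i=a..b. G i)"
proof -
  have "(\<Sum>i=c..d. G (i + k)) = (\<Sum>i=c+k..d+k. G i)"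
    by (rule sum.reindex_bij_witness[of _ "\<lambda>i. i - k" "\<lambda>i. i + k"]) auto
  also have "\<dots> = (\<Sum>i=a..b. G i)"
    using assms by (intro sum.mono_neutral_right) auto
  finally show ?thesis .
qed

text \<open>For constant \<open>c\<close> the sum is half the sum of the squared second differences. In general, summation
  by parts leaves a remainder in which only the increments of \<open>c\<close> occur.\<close>

lemma upwind_third_difference_ge:
  fixes V c :: "int \<Rightarrow> real" and m :: int
  assumes V: "\<And>i. i \<notin> {0..m} \<Longrightarrow> V i = 0"
    and c: "\<And>i. 0 \<le> c i" "\<And>i. c (i + 1) \<le> c i" "\<And>i. c i - c (i + 1) \<le> \<eta>"
  shows "- (2 * \<eta> * (\<Sum>i=0..m. (V i)\<^sup>2))
    \<le> (\<Sum>i=0..m. c i * V i * (V (i + 2) - 3 * V (i + 1) + 3 * V i - V (i - 1)))"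
proof -
  \<comment> \<open>\<open>G\<close> is chosen so that \<open>q * (s - 3 * r + 3 * q - p) = G q r s
    - G p q r + (s - 2 * r + q)\<^sup>2 / 2\<close>: for constant \<open>c\<close> the first two
    terms telescope and a square remains.\<close>
  define G where "G q r s = - 5 / 2 * r\<^sup>2 - s\<^sup>2 / 2 + q * r + 2 * r * s" for q r s :: real
  define F where "F i = c i * G (V (i - 1)) (V i) (V (i + 1))" for i
  let ?T = "\<lambda>i. c i * V i * (V (i + 2) - 3 * V (i + 1) + 3 * V i - V (i - 1))"
  let ?K = "\<lambda>i. (V i)\<^sup>2 / 2 + (V (i + 1))\<^sup>2 + (V (i + 2))\<^sup>2 / 2"
  have pointwise: "F (i + 1) - F i - \<eta> * ?K i \<le> ?T i" for i
  proof -
    define p q r s where pqrs: "p = V (i - 1)" "q = V i" "r = V (i + 1)" "s = V (i + 2)"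
    define d where "d = c i - c (i + 1)"
    have T: "?T i = F (i + 1) - F i + d * (G q r s + (s - 2 * r + q)\<^sup>2 / 2)
        + c (i + 1) * ((s - 2 * r + q)\<^sup>2 / 2)"
      by (simp add: F_def G_def pqrs d_def algebra_simps power2_eq_square
          add_divide_distrib diff_divide_distrib)
    \<comment> \<open>The factor of the increment \<open>d\<close> exceeds \<open>- ?K i\<close> by
      two squares. The coefficients 1/2, 1, 1/2 of \<open>?K\<close> add up to the factor 2 in the
      claim.\<close>
    have "G q r s + (s - 2 * r + q)\<^sup>2 / 2 = - ?K i + (q + s)\<^sup>2 / 2 + (q - r)\<^sup>2 / 2"
      by (simp add: G_def pqrs algebra_simps power2_eq_square add_divide_distrib diff_divide_distrib)
    then have "d * (- ?K i) \<le> d * (G q r s + (s - 2 * r + q)\<^sup>2 / 2)"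
      using c(2)[of i] by (intro mult_left_mono) (auto simp: d_def)
    moreover have "d * ?K i \<le> \<eta> * ?K i"
      using c(3)[of i] by (intro mult_right_mono) (auto simp: d_def)
    moreover have "0 \<le> c (i + 1) * ((s - 2 * r + q)\<^sup>2 / 2)"
      using c(1) by simp
    ultimately show ?thesis
      unfolding T by linarith
  qed
  have F0: "F i = 0" if "i \<notin> {-1..m+1}" for i
    using that V[of "i - 1"] V[of i] V[of "i + 1"] by (auto simp: F_def G_def)
  \<comment> \<open>Three extra indices on each side keep the shifted supports of \<open>F\<close>
    and \<open>V\<close> inside the range. Hence the two sums of \<open>F\<close> cancel, and each
    shifted square sums to the same value.\<close>
  have F: "(\<Sum>i=-3..m+3. F (i + k)) = (\<Sum>i=-1..m+1. F i)" if "k \<in> {0, 1}" for k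
    using that F0 by (intro sum_shift_supported) auto
  have sq: "(\<Sum>i=-3..m+3. (V (i + k))\<^sup>2) = (\<Sum>i=0..m. (V i)\<^sup>2)" if "k \<in> {0, 1, 2}" for k
    using that V by (intro sum_shift_supported) auto
  have "(\<Sum>i=-3..m+3. F (i + 1) - F i - \<eta> * ?K i) = - (2 * \<eta> * (\<Sum>i=0..m. (V i)\<^sup>2))"
    using F[of 0] F[of 1] sq[of 0] sq[of 1] sq[of 2]
    by (simp add: sum_subtractf sum.distrib flip: sum_distrib_left sum_divide_distrib)
  moreover have "(\<Sum>i=-3..m+3. F (i + 1) - F i - \<eta> * ?K i) \<le> (\<Sum>i=-3..m+3. ?T i)"
    by (intro sum_mono pointwise)
  moreover have "(\<Sum>i=-3..m+3. ?T i) = (\<Sum>i=0..m. ?T i)"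
    using V by (intro sum.mono_neutral_right) auto
  ultimately show ?thesis by simp
qed

lemma sum_reflect: "(\<Sum>i=0..m. g (m - i)) = (\<Sum>i=0..m. g i)" for m :: int
  by (rule sum.reindex_bij_witness[of _ "\<lambda>i. m - i" "\<lambda>i. m - i"]) auto

text \<open>Reflecting \<open>i\<close> to \<open>m - i\<close> exchanges the two one-sided stencils
  and makes an increasing coefficient decreasing, which reduces the claim to the upwind
  case.\<close>

lemma downwind_third_difference_ge:
  fixes V c :: "int \<Rightarrow> real" and m :: int
  assumes V: "\<And>i. i \<notin> {0..m} \<Longrightarrow> V i = 0"
    and c: "\<And>i. 0 \<le> c i" "\<And>i. c i \<le> c (i + 1)" "\<And>i. c (i + 1) - c i \<le> \<eta>"
  shows "- (2 * \<eta> * (\<Sum>i=0..m. (V i)\<^sup>2))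
    \<le> (\<Sum>i=0..m. c i * V i * (V (i - 2) - 3 * V (i - 1) + 3 * V i - V (i + 1)))"
proof -
  have shift: "m - i - 1 + 1 = m - i" "m - (i + 1) = m - i - 1" "m - (i + 2) = m - i - 2"
    "m - (i - 1) = m - i + 1" for i
    by auto
  have "- (2 * \<eta> * (\<Sum>i=0..m. (V (m - i))\<^sup>2))
    \<le> (\<Sum>i=0..m. c (m - i) * V (m - i) * (V (m - (i + 2)) - 3 * V (m - (i + 1))
        + 3 * V (m - i) - V (m - (i - 1))))"
  proof (rule upwind_third_difference_ge)
    fix i
    show "V (m - i) = 0" if "i \<notin> {0..m}" using that V[of "m - i"] by auto
    show "0 \<le> c (m - i)" by (rule c)
    show "c (m - (i + 1)) \<le> c (m - i)" "c (m - i) - c (m - (i + 1)) \<le> \<eta>"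
      using c(2)[of "m - i - 1"] c(3)[of "m - i - 1"] by (auto simp: shift)
  qed
  then show ?thesis
    unfolding shift
      sum_reflect[of "\<lambda>i. c i * V i * (V (i - 2) - 3 * V (i - 1) + 3 * V i - V (i + 1))" m]
      sum_reflect[of "\<lambda>i. (V i)\<^sup>2" m] .
qed

text \<open>This is \<open>2 * x * y \<le> x\<^sup>2 + y\<^sup>2\<close> summed up; shifting does
  not change the total of the squares.\<close>

lemma sum_mult_succ_le:
  fixes V :: "int \<Rightarrow> real" and m :: int
  assumes V: "\<And>i. i \<notin> {0..m} \<Longrightarrow> V i = 0"
  shows "(\<Sum>i=0..m. V i * V (i + 1)) \<le> (\<Sum>i=0..m. (V i)\<^sup>2)"
    and "(\<Sum>i=0..m. V i * V (i - 1)) \<le> (\<Sum>i=0..m. (V i)\<^sup>2)"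
proof -
  have sq: "(\<Sum>i=-1..m+1. (V (i + k))\<^sup>2) = (\<Sum>i=0..m. (V i)\<^sup>2)" if "k \<in> {-1, 0, 1}" for k
    using that V by (intro sum_shift_supported) auto
  have *: "(\<Sum>i=0..m. V i * V (i + k)) \<le> (\<Sum>i=0..m. (V i)\<^sup>2)" if k: "k \<in> {-1, 1}" for k
  proof -
    have "(\<Sum>i=0..m. V i * V (i + k)) = (\<Sum>i=-1..m+1. V i * V (i + k))"
      using V by (intro sum.mono_neutral_left) auto
    also have "\<dots> \<le> (\<Sum>i=-1..m+1. ((V i)\<^sup>2 + (V (i + k))\<^sup>2) / 2)"
    proof (intro sum_mono)
      show "V i * V (i + k) \<le> ((V i)\<^sup>2 + (V (i + k))\<^sup>2) / 2" for i
        using sum_squares_bound[of "V i" "V (i + k)"] by simp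
    qed
    also have "\<dots> = (\<Sum>i=0..m. (V i)\<^sup>2)"
      using sq[of k] sq[of 0] k by (auto simp: sum.distrib simp flip: sum_divide_distrib)
    finally show ?thesis .
  qed
  show "(\<Sum>i=0..m. V i * V (i + 1)) \<le> (\<Sum>i=0..m. (V i)\<^sup>2)"
    and "(\<Sum>i=0..m. V i * V (i - 1)) \<le> (\<Sum>i=0..m. (V i)\<^sup>2)"
    using *[of 1] *[of "-1"] by simp_all
qed

lemma second_difference_nonpos:
  fixes V :: "int \<Rightarrow> real" and m :: int
  assumes V: "\<And>i. i \<notin> {0..m} \<Longrightarrow> V i = 0"
  shows "(\<Sum>i=0..m. V i * (V (i - 1) - 2 * V i + V (i + 1))) \<le> 0"
proof -
  have "(\<Sum>i=0..m. V i * (V (i - 1) - 2 * V i + V (i + 1)))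
    = (\<Sum>i=0..m. V i * V (i - 1)) + (\<Sum>i=0..m. V i * V (i + 1)) - 2 * (\<Sum>i=0..m. (V i)\<^sup>2)"
    by (simp add: sum.distrib sum_subtractf sum_distrib_left power2_eq_square algebra_simps)
  then show ?thesis using sum_mult_succ_le[of m V] V by simp
qed

text \<open>Here \<open>a\<close> is affine with slope \<open>- \<eta>\<close> per node. The
  products \<open>a i * V i * V (i - 1)\<close> telescope up to that slope, so only
  \<open>\<eta>\<close> times a sum of neighbour products survives.\<close>

lemma central_difference_le:
  fixes V a :: "int \<Rightarrow> real" and m :: int
  assumes V: "\<And>i. i \<notin> {0..m} \<Longrightarrow> V i = 0" and a: "\<And>i. a i - a (i + 1) = \<eta>" and "0 \<le> \<eta>"
  shows "(\<Sum>i=0..m. a i * V i * (V (i + 1) - V (i - 1))) \<le> \<eta> * (\<Sum>i=0..m. (V i)\<^sup>2)"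
proof -
  define F where "F i = a i * V i * V (i - 1)" for i
  have "F (i + 1) - F i + \<eta> * (V i * V (i + 1)) = a i * V i * (V (i + 1) - V (i - 1))" for i
    by (simp add: F_def algebra_simps flip: a[of i])
  then have "(\<Sum>i=0..m. a i * V i * (V (i + 1) - V (i - 1)))
      = (\<Sum>i=0..m. F (i + 1) - F i + \<eta> * (V i * V (i + 1)))" by simp
  also have "\<dots> = (\<Sum>i=-1..m+1. F (i + 1) - F i + \<eta> * (V i * V (i + 1)))"
    using V by (intro sum.mono_neutral_left) (auto simp: F_def)
  also have "\<dots> = (\<Sum>i=-1..m+1. F (i + 1)) - (\<Sum>i=-1..m+1. F (i + 0))
      + \<eta> * (\<Sum>i=-1..m+1. V i * V (i + 1))"
    by (simp add: sum.distrib sum_subtractf sum_distrib_left)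
  also have "(\<Sum>i=-1..m+1. F (i + 1)) = (\<Sum>i=0..m. F i)"
    using V by (intro sum_shift_supported) (auto simp: F_def)
  also have "(\<Sum>i=-1..m+1. F (i + 0)) = (\<Sum>i=0..m. F i)"
    using V by (intro sum_shift_supported) (auto simp: F_def)
  also have "(\<Sum>i=-1..m+1. V i * V (i + 1)) = (\<Sum>i=0..m. V i * V (i + 1))"
    using V by (intro sum.mono_neutral_right) auto
  also have "(\<Sum>i=0..m. F i) - (\<Sum>i=0..m. F i) + \<eta> * (\<Sum>i=0..m. V i * V (i + 1))
      \<le> \<eta> * (\<Sum>i=0..m. (V i)\<^sup>2)"
    using sum_mult_succ_le(1)[of m V] V \<open>0 \<le> \<eta>\<close> by (simp add: mult_left_mono)
  finally show ?thesis .
qed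

text \<open>Three linear moment equations for four weights leave \<open>w 2\<close> as the only free
  parameter.\<close>

lemma weight_conditions_solve:
  assumes "weight_conditions w"
  shows "w (-1) = - 1 / 2 - w 2" "w 0 = 3 * w 2" "w 1 = 1 / 2 - 3 * w 2" "w 2 \<le> 0"
proof -
  have "{-1..2::int} = {-1, 0, 1, 2}" by auto
  then show "w (-1) = - 1 / 2 - w 2" "w 0 = 3 * w 2" "w 1 = 1 / 2 - 3 * w 2" "w 2 \<le> 0"
    using assms by (auto simp: weight_conditions_def)
qed

text \<open>The weights are those of the central difference plus \<open>w 2\<close> times those of the one-sided third
  difference.\<close>

lemma advection_le:
  fixes V a :: "int \<Rightarrow> real" and m :: int
  assumes V: "\<And>i. i \<notin> {0..m} \<Longrightarrow> V i = 0" and a: "\<And>i. a i - a (i + 1) = \<eta>" and "0 \<le> \<eta>" "0 < h"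
    and w: "weight_conditions w"
  shows "(\<Sum>i=0..m. V i *
      (pos_part (a i) *
         ((w 2 * V (i + 2) + w 1 * V (i + 1) + w 0 * V i + w (-1) * V (i - 1)) / h)
     + neg_part (a i) *
         ((- w (-1) * V (i + 1) - w 0 * V i - w 1 * V (i - 1) - w 2 * V (i - 2)) / h)))
    \<le> (\<bar>w (-1)\<bar> - 10 * w 2) * (\<eta> / h) * (\<Sum>i=0..m. (V i)\<^sup>2)"
    (is "(\<Sum>i=0..m. ?t i) \<le> _")
proof -
  let ?up = "\<lambda>i. pos_part (a i) * V i * (V (i + 2) - 3 * V (i + 1) + 3 * V i - V (i - 1))"
  let ?down = "\<lambda>i. - neg_part (a i) * V i * (V (i - 2) - 3 * V (i - 1) + 3 * V i - V (i + 1))"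
  let ?S = "\<Sum>i=0..m. (V i)\<^sup>2"
  note ws = weight_conditions_solve[OF w]
  have "?t i = (a i * V i * (V (i + 1) - V (i - 1)) / 2 + w 2 * ?up i + w 2 * ?down i) / h" for i
  proof -
    have "a i = pos_part (a i) + neg_part (a i)" by (simp add: max_def min_def)
    then have "a i * V i * (V (i + 1) - V (i - 1)) / 2
      = (pos_part (a i) + neg_part (a i)) * V i * (V (i + 1) - V (i - 1)) / 2" by simp
    then show ?thesis
      using \<open>0 < h\<close> by (simp add: ws(1-3) field_simps)
  qed
  then have "(\<Sum>i=0..m. ?t i)
      = (\<Sum>i=0..m. (a i * V i * (V (i + 1) - V (i - 1)) / 2 + w 2 * ?up i + w 2 * ?down i) / h)"
    by (intro sum.cong refl)
  also have "\<dots> = ((\<Sum>i=0..m. a i * V i * (V (i + 1) - V (i - 1))) / 2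
      + w 2 * (\<Sum>i=0..m. ?up i) + w 2 * (\<Sum>i=0..m. ?down i)) / h"
    by (simp only: sum.distrib sum_distrib_left[symmetric] sum_divide_distrib[symmetric])
  \<comment> \<open>Since \<open>w 2\<close> is nonpositive, the lower bounds for the third
    differences become upper bounds. The positive and negative parts of the drift inherit its
    monotonicity and its step bound \<open>\<eta>\<close>.\<close>
  also have "\<dots> \<le> (\<eta> * ?S / 2 + w 2 * (- (2 * \<eta> * ?S)) + w 2 * (- (2 * \<eta> * ?S))) / h"
  proof (intro divide_right_mono add_mono mult_left_mono_neg ws(4))
    show "- (2 * \<eta> * ?S) \<le> (\<Sum>i=0..m. ?up i)"
    proof (rule upwind_third_difference_ge)
      show "pos_part (a (i + 1)) \<le> pos_part (a i)" "pos_part (a i) - pos_part (a (i + 1)) \<le> \<eta>" for i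
        using a[of i] \<open>0 \<le> \<eta>\<close> by auto
    qed (use V in auto)
    show "- (2 * \<eta> * ?S) \<le> (\<Sum>i=0..m. ?down i)"
    proof (rule downwind_third_difference_ge)
      show "- neg_part (a i) \<le> - neg_part (a (i + 1))"
        "- neg_part (a (i + 1)) - - neg_part (a i) \<le> \<eta>" for i
        using a[of i] \<open>0 \<le> \<eta>\<close> by auto
    qed (use V in auto)
  qed (use central_difference_le[of m V a \<eta>] V a assms(3,4) in auto)
  \<comment> \<open>The 1/2 comes from the central difference, and each one-sided third difference
    contributes \<open>- 2 * w 2\<close>.\<close>
  also have "\<dots> = (1 / 2 - 4 * w 2) * (\<eta> / h * ?S)"
    by (simp add: algebra_simps add_divide_distrib diff_divide_distrib)
  \<comment> \<open>As \<open>\<bar>w (-1)\<bar> \<ge> 1 / 2 + w 2\<close>, the new constant is at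
    least \<open>1 / 2 - 9 * w 2\<close>, which dominates because
    \<open>w 2 \<le> 0\<close>.\<close>
  also have "\<dots> \<le> (\<bar>w (-1)\<bar> - 10 * w 2) * (\<eta> / h * ?S)"
    using assms(3,4) ws(4) ws(1) by (intro mult_right_mono) (auto simp: sum_nonneg)
  finally show ?thesis by (simp add: mult.assoc)
qed

section \<open>The jump kernel\<close>

text \<open>Neighbouring closed cells share an end point. Passing to the gauge integral lets them be
  joined one after another by \<open>integral_combine\<close>.\<close>

lemma sum_set_integral_adjacent_cells:
  fixes z :: "int \<Rightarrow> real" and g :: "real \<Rightarrow> real"
  assumes z: "mono z" and g: "integrable lborel g"
  shows "(\<Sum>l=-1..int n. LBINT s:{z l..z (l + 1)}. g s) = (LBINT s:{z (-1)..z (int n + 1)}. g s)"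
proof -
  have cell: "(LBINT s:{a..b}. g s) = integral {a..b} g" "g integrable_on {a..b}" for a b
  proof -
    have "set_integrable lborel {a..b} g"
      unfolding set_integrable_def using g by (intro integrable_mult_indicator) auto
    then show "(LBINT s:{a..b}. g s) = integral {a..b} g" "g integrable_on {a..b}"
      by (simp_all add: set_borel_integral_eq_integral)
  qed
  have glue: "integral {z (-1)..z l} g + integral {z l..z (l + 1)} g = integral {z (-1)..z (l + 1)} g"
    if "-1 \<le> l" for l
    using that z cell(2) by (intro Henstock_Kurzweil_Integration.integral_combine) (auto simp: monoD)
  have ivl: "{-1..0::int} = {-1, 0}" "{-1..1 + int n} = insert (1 + int n) {-1..int n}" for n
    by auto
  show ?thesis
  proof (induction n)
    case 0
    then show ?case using glue[of 0] by (simp add: cell ivl)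
  next
    case (Suc n)
    then show ?case using glue[of "1 + int n"] by (simp add: cell(1) ivl add_ac)
  qed
qed

text \<open>Meant for \<open>u\<close> being one half of a hat function. The shifted density
  dominates the integrand, which gives integrability; pulling out its supremum gives the last
  bound.\<close>

lemma set_integral_mult_density:
  fixes u f :: "real \<Rightarrow> real"
  assumes f: "bounded_prob_density f" and u: "u \<in> borel_measurable borel"
    and u01: "\<And>s. s \<in> {a..b} \<Longrightarrow> 0 \<le> u s \<and> u s \<le> 1"
  shows "set_integrable lborel {a..b} (\<lambda>s. u s * f (s - y))"
    and "0 \<le> (LBINT s:{a..b}. u s * f (s - y))"
    and "(LBINT s:{a..b}. u s * f (s - y)) \<le> sup_norm f * (LBINT s:{a..b}. u s)"
proof -
  have f0: "0 \<le> f s" for s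
    using f by (simp add: bounded_prob_density_def)
  have fle: "f s \<le> sup_norm f" for s
  proof -
    have "\<bar>f s\<bar> \<le> sup_norm f"
      unfolding sup_norm_def using f by (intro cSUP_upper) (auto simp: bounded_prob_density_def)
    then show ?thesis by simp
  qed
  have [measurable]: "u \<in> borel_measurable borel" "f \<in> borel_measurable borel"
    using f u by (auto simp: bounded_prob_density_def)
  have "integrable lborel f"
    using f by (auto simp: bounded_prob_density_def integrable.intros)
  then have "integrable lborel (\<lambda>s. f (- y + 1 * s))"
    by (rule lborel_integrable_real_affine) simp
  then have shift: "integrable lborel (\<lambda>s. f (s - y))" by simp
  show int: "set_integrable lborel {a..b} (\<lambda>s. u s * f (s - y))"
    unfolding set_integrable_def
  proof (rule Bochner_Integration.integrable_bound[OF shift])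
    show "AE s in lborel. norm (indicator {a..b} s *\<^sub>R (u s * f (s - y))) \<le> norm (f (s - y))"
      using u01 f0 by (intro AE_I2) (auto simp: indicator_def abs_mult intro!: mult_left_le_one_le)
  qed measurable
  have "set_integrable lborel {a..b} (\<lambda>s. 1 :: real)"
    by (simp add: set_integrable_def integrable_real_indicator emeasure_lborel_Icc_eq)
  then have intu: "set_integrable lborel {a..b} u"
    unfolding set_integrable_def
  proof (rule Bochner_Integration.integrable_bound)
    show "AE s in lborel. norm (indicator {a..b} s *\<^sub>R u s) \<le> norm (indicator {a..b} s *\<^sub>R (1::real))"
      using u01 by (intro AE_I2) (auto simp: indicator_def)
  qed measurable
  show "0 \<le> (LBINT s:{a..b}. u s * f (s - y))"
    unfolding set_lebesgue_integral_def using u01 f0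
    by (intro integral_nonneg_AE AE_I2) (auto simp: indicator_def)
  have "(LBINT s:{a..b}. u s * f (s - y)) \<le> (LBINT s:{a..b}. sup_norm f * u s)"
  proof (rule set_integral_mono[OF int])
    show "u s * f (s - y) \<le> sup_norm f * u s" if "s \<in> {a..b}" for s
      using mult_left_mono[OF fle[of "s - y"], of "u s"] u01[OF that] by (simp add: mult.commute)
  qed (use intu in simp)
  then show "(LBINT s:{a..b}. u s * f (s - y)) \<le> sup_norm f * (LBINT s:{a..b}. u s)"
    by simp
qed

text \<open>Each value is the area of a right triangle of height 1 over the cell, computed from the
  antiderivatives \<open>(b * s - s\<^sup>2 / 2) / (b - a)\<close> and
  \<open>(s\<^sup>2 / 2 - a * s) / (b - a)\<close>.\<close>

lemma set_integral_hat_halves: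
  fixes a b :: real
  assumes "a < b"
  shows "(LBINT s:{a..b}. (b - s) / (b - a)) = (b - a) / 2"
    and "(LBINT s:{a..b}. (s - a) / (b - a)) = (b - a) / 2"
proof -
  have "(LBINT s:{a..b}. (b - s) / (b - a))
      = (b * b - b\<^sup>2 / 2) / (b - a) - (b * a - a\<^sup>2 / 2) / (b - a)"
    unfolding set_lebesgue_integral_def using assms
    by (intro integral_FTC_Icc)
      (auto intro!: derivative_eq_intros continuous_intros
        simp flip: has_real_derivative_iff_has_vector_derivative)
  also have "\<dots> = ((b - a) / 2) * (b - a) / (b - a)"
    unfolding diff_divide_distrib[symmetric]
    by (rule arg_cong[where f = "\<lambda>z. z / (b - a)"]) (simp add: power2_eq_square field_simps)
  also have "\<dots> = (b - a) / 2"
    using assms by (intro nonzero_mult_div_cancel_right) simp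
  finally show "(LBINT s:{a..b}. (b - s) / (b - a)) = (b - a) / 2" .
  have "(LBINT s:{a..b}. (s - a) / (b - a))
      = (b\<^sup>2 / 2 - a * b) / (b - a) - (a\<^sup>2 / 2 - a * a) / (b - a)"
    unfolding set_lebesgue_integral_def using assms
    by (intro integral_FTC_Icc)
      (auto intro!: derivative_eq_intros continuous_intros
        simp flip: has_real_derivative_iff_has_vector_derivative)
  also have "\<dots> = ((b - a) / 2) * (b - a) / (b - a)"
    unfolding diff_divide_distrib[symmetric]
    by (rule arg_cong[where f = "\<lambda>z. z / (b - a)"]) (simp add: power2_eq_square field_simps)
  also have "\<dots> = (b - a) / 2"
    using assms by (intro nonzero_mult_div_cancel_right) simp
  finally show "(LBINT s:{a..b}. (s - a) / (b - a)) = (b - a) / 2" .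
qed

text \<open>The weight that cell \<open>l\<close> gives to its left node;
  \<open>kernel_right\<close> is the counterpart for node \<open>l + 1\<close>. Neither depends on
  the grid function, so the jump term becomes a weighted sum of nodal values.\<close>

definition kernel_left :: "problem \<Rightarrow> nat \<Rightarrow> int \<Rightarrow> int \<Rightarrow> real" where
  "kernel_left P m2 j l = (LBINT s:{ynode P m2 l..ynode P m2 (l + 1)}.
     (ynode P m2 (l + 1) - s) / dy P m2 * dens P (s - ynode P m2 j))"

definition kernel_right :: "problem \<Rightarrow> nat \<Rightarrow> int \<Rightarrow> int \<Rightarrow> real" where
  "kernel_right P m2 j l = (LBINT s:{ynode P m2 l..ynode P m2 (l + 1)}.
     (s - ynode P m2 l) / dy P m2 * dens P (s - ynode P m2 j))"

section \<open>Size and total mass of the interpolated jump kernel\<close>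

locale jump_problem =
  fixes P :: problem
  assumes xlim: "xmin P < xmax P" and ylim: "ymin P < ymax P"
    and lam_pos: "0 < lam P" and density: "bounded_prob_density (dens P)"
begin

lemma dx_pos: "0 < dx P m" and dy_pos: "0 < dy P m"
  using xlim ylim by (auto simp: dx_def dy_def)

lemma ynode_Suc: "ynode P m (l + 1) - ynode P m l = dy P m"
  by (simp add: ynode_def algebra_simps)

lemma xnode_Suc: "xnode P m (l + 1) - xnode P m l = dx P m"
  by (simp add: xnode_def algebra_simps)

lemma ynode_mono: "mono (ynode P m)"
  using dy_pos[of m] by (auto simp: ynode_def mono_def intro!: mult_right_mono)

lemma ynode_less: "ynode P m l < ynode P m (l + 1)"
  using ynode_Suc[of m l] dy_pos[of m] by linarith

lemma sup_norm_nonneg: "0 \<le> sup_norm (dens P)"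
proof -
  have "\<bar>dens P 0\<bar> \<le> sup_norm (dens P)"
    unfolding sup_norm_def using density
    by (intro cSUP_upper) (auto simp: bounded_prob_density_def)
  then show ?thesis by linarith
qed

lemma hat_half_bounds:
  assumes "s \<in> {ynode P m l..ynode P m (l + 1)}"
  shows "0 \<le> (ynode P m (l + 1) - s) / dy P m \<and> (ynode P m (l + 1) - s) / dy P m \<le> 1"
    and "0 \<le> (s - ynode P m l) / dy P m \<and> (s - ynode P m l) / dy P m \<le> 1"
  using assms ynode_Suc[of m l] dy_pos[of m] by auto

lemma kernel_left_integrable:
  "set_integrable lborel {ynode P m l..ynode P m (l + 1)}
    (\<lambda>s. (ynode P m (l + 1) - s) / dy P m * dens P (s - ynode P m j))"
  by (rule set_integral_mult_density(1)[OF density _ hat_half_bounds(1)]) measurable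

lemma kernel_right_integrable:
  "set_integrable lborel {ynode P m l..ynode P m (l + 1)}
    (\<lambda>s. (s - ynode P m l) / dy P m * dens P (s - ynode P m j))"
  by (rule set_integral_mult_density(1)[OF density _ hat_half_bounds(2)]) measurable

text \<open>The upper bounds are the supremum of the density times the area
  \<open>dy P m / 2\<close> of a half hat.\<close>

lemma kernel_bounds:
  shows "0 \<le> kernel_left P m j l" "kernel_left P m j l \<le> sup_norm (dens P) * (dy P m / 2)"
    and "0 \<le> kernel_right P m j l" "kernel_right P m j l \<le> sup_norm (dens P) * (dy P m / 2)"
proof -
  note hat = set_integral_hat_halves[OF ynode_less[of m l], unfolded ynode_Suc]
  show "0 \<le> kernel_left P m j l" unfolding kernel_left_def
    by (rule set_integral_mult_density(2)[OF density _ hat_half_bounds(1)]) measurable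
  show "0 \<le> kernel_right P m j l" unfolding kernel_right_def
    by (rule set_integral_mult_density(2)[OF density _ hat_half_bounds(2)]) measurable
  show "kernel_left P m j l \<le> sup_norm (dens P) * (dy P m / 2)"
    unfolding kernel_left_def hat(1)[symmetric]
    by (rule set_integral_mult_density(3)[OF density _ hat_half_bounds(1)]) measurable
  show "kernel_right P m j l \<le> sup_norm (dens P) * (dy P m / 2)"
    unfolding kernel_right_def hat(2)[symmetric]
    by (rule set_integral_mult_density(3)[OF density _ hat_half_bounds(2)]) measurable
qed

text \<open>The two half hats on a cell add up to 1, so the weights collect the mass of the shifted
  density between the outermost nodes.\<close>

lemma kernel_sum_le_1:
  "(\<Sum>l=-1..int m. kernel_left P m j l + kernel_right P m j l) \<le> 1"
proof -
  let ?g = "\<lambda>s. dens P (s - ynode P m j)"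
  have f: "has_bochner_integral lborel (dens P) 1" "\<And>s. 0 \<le> dens P s"
    using density by (auto simp: bounded_prob_density_def)
  have g: "has_bochner_integral lborel ?g 1"
    using lborel_has_bochner_integral_real_affine_iff[of 1 "dens P" 1 "- ynode P m j"] f(1)
    by (simp add: algebra_simps)
  have "kernel_left P m j l + kernel_right P m j l
      = (LBINT s:{ynode P m l..ynode P m (l + 1)}. ?g s)" for l
  proof -
    have "(ynode P m (l + 1) - s) / dy P m * ?g s + (s - ynode P m l) / dy P m * ?g s = ?g s" for s
    proof -
      have "(ynode P m (l + 1) - s) / dy P m + (s - ynode P m l) / dy P m = 1"
        using ynode_Suc[of m l] dy_pos[of m] by (simp flip: add_divide_distrib)
      then show ?thesis by (metis distrib_right mult_1)
    qed
    then show ?thesis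
      using set_integral_add(2)[OF kernel_left_integrable kernel_right_integrable, of m l j j]
      by (simp add: kernel_left_def kernel_right_def)
  qed
  then have "(\<Sum>l=-1..int m. kernel_left P m j l + kernel_right P m j l)
      = (LBINT s:{ynode P m (-1)..ynode P m (int m + 1)}. ?g s)"
    using sum_set_integral_adjacent_cells[OF ynode_mono, of ?g m] g
    by (simp add: has_bochner_integral_iff)
  also have "\<dots> \<le> (LBINT s. ?g s)"
    unfolding set_lebesgue_integral_def
  proof (rule integral_mono)
    show "integrable lborel ?g" using g by (simp add: has_bochner_integral_iff)
    then show "integrable lborel (\<lambda>s. indicator {ynode P m (-1)..ynode P m (int m + 1)} s *\<^sub>R ?g s)"
      by (intro integrable_mult_indicator) auto
  qed (use f(2) in \<open>auto simp: indicator_def\<close>)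
  also have "\<dots> = 1" using g by (simp add: has_bochner_integral_iff)
  finally show ?thesis .
qed

text \<open>In this form linearity in \<open>V\<close> is evident and Jensen's inequality
  applies.\<close>

lemma B_formula_kernel:
  "B_formula P m1 m2 V i j
    = lam P * (\<Sum>l=-1..int m2. kernel_left P m2 j l * V i l + kernel_right P m2 j l * V i (l + 1))"
proof -
  let ?g = "\<lambda>s. dens P (s - ynode P m2 j)"
  have "(LBINT s:{ynode P m2 l..ynode P m2 (l + 1)}.
      ((ynode P m2 (l + 1) - s) / dy P m2 * V i l + (s - ynode P m2 l) / dy P m2 * V i (l + 1)) * ?g s)
    = kernel_left P m2 j l * V i l + kernel_right P m2 j l * V i (l + 1)" for l
  proof -
    have "((ynode P m2 (l + 1) - s) / dy P m2 * V i l + (s - ynode P m2 l) / dy P m2 * V i (l + 1)) * ?g s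
      = (ynode P m2 (l + 1) - s) / dy P m2 * ?g s * V i l
        + (s - ynode P m2 l) / dy P m2 * ?g s * V i (l + 1)" for s
      by (simp add: algebra_simps)
    then show ?thesis
      using kernel_left_integrable[of m2 l j] kernel_right_integrable[of m2 l j]
      unfolding kernel_left_def kernel_right_def
      by (simp only: set_integral_add(2) set_integrable_mult_left set_integral_mult_left)
  qed
  then show ?thesis by (simp add: B_formula_def)
qed

text \<open>Jensen's inequality for weights of total mass at most 1, followed by the pointwise
  kernel bounds. The result is uniform in \<open>j\<close>, so that a later summation over
  \<open>j\<close> costs only the length of the y-interval.\<close>

lemma B_formula_square_le:
  assumes V: "\<And>l. l \<notin> {0..int m2} \<Longrightarrow> V i l = 0"
  shows "(B_formula P m1 m2 V i j)\<^sup>2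
    \<le> (lam P)\<^sup>2 * (sup_norm (dens P) * dy P m2 * (\<Sum>l=0..int m2. (V i l)\<^sup>2))"
proof -
  let ?L = "kernel_left P m2 j" and ?R = "kernel_right P m2 j" and ?c = "sup_norm (dens P) * (dy P m2 / 2)"
  define S where "S = (\<Sum>l=-1..int m2. ?L l * V i l + ?R l * V i (l + 1))"
  define W where "W = (\<Sum>l=-1..int m2. ?L l * (V i l)\<^sup>2 + ?R l * (V i (l + 1))\<^sup>2)"
  define \<theta> where "\<theta> = (\<Sum>l=-1..int m2. ?L l + ?R l)"
  \<comment> \<open>Jensen: the weighted variance around \<open>S\<close> is nonnegative.\<close>
  have "0 \<le> (\<Sum>l=-1..int m2. ?L l * (V i l - S)\<^sup>2 + ?R l * (V i (l + 1) - S)\<^sup>2)"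
    by (intro sum_nonneg) (simp add: kernel_bounds)
  also have "\<dots> = (\<Sum>l=-1..int m2. (?L l * (V i l)\<^sup>2 + ?R l * (V i (l + 1))\<^sup>2)
      - 2 * S * (?L l * V i l + ?R l * V i (l + 1)) + S\<^sup>2 * (?L l + ?R l))"
    by (intro sum.cong refl) (simp add: algebra_simps power2_eq_square)
  also have "\<dots> = W - 2 * S * S + S\<^sup>2 * \<theta>"
    unfolding sum.distrib sum_subtractf sum_distrib_left[symmetric] W_def \<theta>_def S_def ..
  \<comment> \<open>Because \<open>\<theta>\<close> is at most 1, the last term restores at most one
    of the two subtracted squares of \<open>S\<close>.\<close>
  finally have "S\<^sup>2 \<le> W"
    using mult_left_mono[OF kernel_sum_le_1[where m=m2 and j=j], of "S\<^sup>2"]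
    by (simp add: \<theta>_def power2_eq_square)
  \<comment> \<open>Every interior node is the right end of one cell and the left end of the next;
    the two contributions with \<open>dy P m2 / 2\<close> add up to a full
    \<open>dy P m2\<close>.\<close>
  also have "W \<le> (\<Sum>l=-1..int m2. ?c * (V i (l + 0))\<^sup>2 + ?c * (V i (l + 1))\<^sup>2)"
    unfolding W_def by (intro sum_mono add_mono mult_mono kernel_bounds)
      (auto simp: sup_norm_nonneg dy_pos less_imp_le)
  also have "\<dots> = ?c * (\<Sum>l=-1..int m2. (V i (l + 0))\<^sup>2) + ?c * (\<Sum>l=-1..int m2. (V i (l + 1))\<^sup>2)"
    by (simp add: sum.distrib sum_distrib_left)
  also have "(\<Sum>l=-1..int m2. (V i (l + 0))\<^sup>2) = (\<Sum>l=0..int m2. (V i l)\<^sup>2)"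
    using V by (intro sum_shift_supported) auto
  also have "(\<Sum>l=-1..int m2. (V i (l + 1))\<^sup>2) = (\<Sum>l=0..int m2. (V i l)\<^sup>2)"
    using V by (intro sum_shift_supported) auto
  finally have "S\<^sup>2 \<le> sup_norm (dens P) * dy P m2 * (\<Sum>l=0..int m2. (V i l)\<^sup>2)"
    by (simp add: algebra_simps)
  then show ?thesis
    unfolding B_formula_kernel S_def[symmetric] power_mult_distrib by (intro mult_left_mono) auto
qed

end

section \<open>Grid vectors and the quadratic form\<close>

lemma gvec_carrier: "gvec m1 m2 F \<in> carrier_vec (gdim m1 m2)"
  by (simp add: gvec_def)

lemma index_gvec:
  "k < gdim m1 m2 \<Longrightarrow> vec_index (gvec m1 m2 F) k = F (int (k div (m2 + 1))) (int (k mod (m2 + 1)))"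
  by (simp add: gvec_def)

lemma node_number_less:
  assumes "0 \<le> i" "i \<le> int m1" "0 \<le> j" "j \<le> int m2"
  shows "nat i * (m2 + 1) + nat j < gdim m1 m2"
proof -
  have "nat i * (m2 + 1) + nat j < nat i * (m2 + 1) + (m2 + 1)"
    using assms by (intro add_strict_left_mono) linarith
  also have "\<dots> = (nat i + 1) * (m2 + 1)" by simp
  also have "\<dots> \<le> gdim m1 m2" unfolding gdim_def using assms by (intro mult_right_mono) auto
  finally show ?thesis .
qed

text \<open>Division with remainder by \<open>m2 + 1\<close> is the bijection between entry numbers
  and interior nodes.\<close>

lemma sum_over_grid:
  "(\<Sum>k<gdim m1 m2. F (int (k div (m2 + 1))) (int (k mod (m2 + 1))))
    = (\<Sum>i=0..int m1. \<Sum>j=0..int m2. F i j)"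
proof -
  have divmod: "(nat i * (m2 + 1) + nat j) div (m2 + 1) = nat i"
    "(nat i * (m2 + 1) + nat j) mod (m2 + 1) = nat j"
    if "0 \<le> j" "j \<le> int m2" for i j
    using that by (auto simp del: mult_Suc_right simp: div_add1_eq mod_add_eq)
  have "(\<Sum>k<gdim m1 m2. F (int (k div (m2 + 1))) (int (k mod (m2 + 1))))
    = (\<Sum>(i, j)\<in>{0..int m1} \<times> {0..int m2}. F i j)"
  proof (rule sum.reindex_bij_witness[of _ "\<lambda>(i, j). nat i * (m2 + 1) + nat j"
      "\<lambda>k. (int (k div (m2 + 1)), int (k mod (m2 + 1)))"])
    fix k assume k: "k \<in> {..<gdim m1 m2}"
    show "(case (int (k div (m2 + 1)), int (k mod (m2 + 1))) of (i, j) \<Rightarrow> nat i * (m2 + 1) + nat j) = k"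
      by (simp only: prod.case nat_int div_mult_mod_eq)
    have "k div (m2 + 1) < m1 + 1"
      using k by (intro less_mult_imp_div_less) (simp add: gdim_def)
    then have "k div (m2 + 1) \<le> m1" by linarith
    moreover have "k mod (m2 + 1) \<le> m2"
      using mod_less_divisor[of "m2 + 1" k] by linarith
    ultimately show "(int (k div (m2 + 1)), int (k mod (m2 + 1))) \<in> {0..int m1} \<times> {0..int m2}"
      by (simp only: mem_Sigma_iff atLeastAtMost_iff of_nat_le_iff of_nat_0_le_iff simp_thms)
  next
    fix p assume p: "p \<in> {0..int m1} \<times> {0..int m2}"
    obtain i j where ij: "p = (i, j)" by force
    with p have "0 \<le> i" "i \<le> int m1" "0 \<le> j" "j \<le> int m2" by auto
    with node_number_less divmod ij
    show "(case p of (i, j) \<Rightarrow> nat i * (m2 + 1) + nat j) \<in> {..<gdim m1 m2}"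
      and "(int ((case p of (i, j) \<Rightarrow> nat i * (m2 + 1) + nat j) div (m2 + 1)),
        int ((case p of (i, j) \<Rightarrow> nat i * (m2 + 1) + nat j) mod (m2 + 1))) = p"
      by (simp_all only: prod.case lessThan_iff int_nat_eq if_True)
  qed auto
  then show ?thesis by (simp add: sum.cartesian_product)
qed

lemma zero_ext_at_node:
  assumes "k < gdim m1 m2"
  shows "zero_ext m1 m2 V (int (k div (m2 + 1))) (int (k mod (m2 + 1))) = vec_index V k"
proof -
  have "k div (m2 + 1) < m1 + 1"
    using assms by (intro less_mult_imp_div_less) (simp add: gdim_def)
  then have "k div (m2 + 1) \<le> m1" by linarith
  moreover have "k mod (m2 + 1) \<le> m2"
    using mod_less_divisor[of "m2 + 1" k] by linarith
  ultimately show ?thesis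
    unfolding zero_ext_def by (simp only: of_nat_le_iff of_nat_0_le_iff simp_thms if_True nat_int div_mult_mod_eq)
qed

lemma zero_ext_eq_0:
  "i \<notin> {0..int m1} \<or> j \<notin> {0..int m2} \<Longrightarrow> zero_ext m1 m2 V i j = 0"
  by (auto simp: zero_ext_def)

text \<open>Extension by zero is linear. The expansion matches the definition of
  \<open>formula_mat\<close>, whose columns are images of unit vectors.\<close>

lemma zero_ext_unit_expansion:
  "zero_ext m1 m2 V i j
    = (\<Sum>q<gdim m1 m2. vec_index V q * zero_ext m1 m2 (unit_vec (gdim m1 m2) q) i j)"
proof (cases "0 \<le> i \<and> i \<le> int m1 \<and> 0 \<le> j \<and> j \<le> int m2")
  case True
  then have k: "nat i * (m2 + 1) + nat j < gdim m1 m2" by (intro node_number_less) auto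
  then have "(\<Sum>q<gdim m1 m2. vec_index V q * vec_index (unit_vec (gdim m1 m2) q) (nat i * (m2 + 1) + nat j))
      = (\<Sum>q<gdim m1 m2. if q = nat i * (m2 + 1) + nat j then vec_index V q else 0)"
    by (intro sum.cong refl) (simp add: unit_vec_def)
  also have "\<dots> = vec_index V (nat i * (m2 + 1) + nat j)"
    using k by simp
  finally show ?thesis using True by (simp add: zero_ext_def)
qed (auto simp: zero_ext_def)

lemma formula_mat_carrier: "formula_mat m1 m2 S \<in> carrier_mat (gdim m1 m2) (gdim m1 m2)"
  by (simp add: formula_mat_def)

text \<open>Additivity and homogeneity let \<open>S\<close> pass through the finite expansion of
  \<open>V\<close> in unit vectors. This allows working with the stencil formulas instead of matrix
  entries.\<close>

lemma formula_mat_mult_vec: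
  assumes add: "\<And>F G i j. S (\<lambda>i j. F i j + G i j) i j = S F i j + S G i j"
    and scale: "\<And>c F i j. S (\<lambda>i j. c * F i j) i j = c * S F i j"
    and V: "V \<in> carrier_vec (gdim m1 m2)"
  shows "formula_mat m1 m2 S *\<^sub>v V = gvec m1 m2 (S (zero_ext m1 m2 V))"
proof (rule eq_vecI)
  fix k assume "k < dim_vec (gvec m1 m2 (S (zero_ext m1 m2 V)))"
  then have k: "k < gdim m1 m2" by (simp add: gvec_def)
  define i j where ij: "i = int (k div (m2 + 1))" "j = int (k mod (m2 + 1))"
  let ?E = "\<lambda>q. zero_ext m1 m2 (unit_vec (gdim m1 m2) q)"
  have zero: "S (\<lambda>i j. 0) i j = 0" using scale[of 0] by simp
  have sum: "S (\<lambda>i j. \<Sum>q\<in>Q. c q * F q i j) i j = (\<Sum>q\<in>Q. c q * S (F q) i j)"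
    if "finite Q" for Q :: "nat set" and c F
    using that by (induction Q rule: finite_induct) (simp_all add: zero add scale)
  have "vec_index (formula_mat m1 m2 S *\<^sub>v V) k
      = (\<Sum>q<gdim m1 m2. vec_index V q * S (?E q) i j)"
    using k V by (auto simp: formula_mat_def scalar_prod_def index_gvec ij atLeast0LessThan mult.commute
        intro!: sum.cong)
  also have "\<dots> = S (zero_ext m1 m2 V) i j"
    using sum[of "{..<gdim m1 m2}" "vec_index V" ?E]
    by (simp flip: zero_ext_unit_expansion)
  finally show "vec_index (formula_mat m1 m2 S *\<^sub>v V) k = vec_index (gvec m1 m2 (S (zero_ext m1 m2 V))) k"
    using k by (simp add: index_gvec ij)
qed (simp add: gvec_def formula_mat_def)

section \<open>The discrete norm and the one-sided bound for the operator\<close>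

context jump_problem
begin

text \<open>The link to \<open>L2_set\<close>, from which the Cauchy-Schwarz and triangle
  inequalities are inherited.\<close>

lemma norm2_L2_set: "norm2 P m1 m2 V = sqrt (dx P m1 * dy P m2) * L2_set (vec_index V) {..<gdim m1 m2}"
  by (simp add: norm2_def grid_inner_def L2_set_def real_sqrt_mult power2_eq_square)

lemma norm2_square: "(norm2 P m1 m2 V)\<^sup>2 = grid_inner P m1 m2 V V"
  unfolding norm2_def grid_inner_def using dx_pos[of m1] dy_pos[of m2]
  by (intro real_sqrt_pow2 mult_nonneg_nonneg[OF _ sum_nonneg]) auto

lemma norm2_nonneg: "0 \<le> norm2 P m1 m2 V"
  using dx_pos dy_pos by (simp add: norm2_L2_set L2_set_nonneg less_imp_le)

lemma abs_grid_inner_le: "\<bar>grid_inner P m1 m2 U V\<bar> \<le> norm2 P m1 m2 U * norm2 P m1 m2 V"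
proof -
  have pos: "0 \<le> dx P m1 * dy P m2" using dx_pos[of m1] dy_pos[of m2] by simp
  have "\<bar>\<Sum>k<gdim m1 m2. vec_index U k * vec_index V k\<bar>
      \<le> (\<Sum>k<gdim m1 m2. \<bar>vec_index U k\<bar> * \<bar>vec_index V k\<bar>)"
    unfolding abs_mult[symmetric] by (rule sum_abs)
  also have "\<dots> \<le> L2_set (vec_index U) {..<gdim m1 m2} * L2_set (vec_index V) {..<gdim m1 m2}"
    by (rule L2_set_mult_ineq)
  finally have "\<bar>grid_inner P m1 m2 U V\<bar> \<le> (sqrt (dx P m1 * dy P m2) * sqrt (dx P m1 * dy P m2))
      * (L2_set (vec_index U) {..<gdim m1 m2} * L2_set (vec_index V) {..<gdim m1 m2})"
    unfolding grid_inner_def abs_mult[of "dx P m1 * dy P m2"] using pos by (simp add: mult_left_mono)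
  then show ?thesis
    by (simp add: norm2_L2_set algebra_simps)
qed

text \<open>The entrywise hypothesis also covers vectors that are not written as a sum and avoids
  carrier conditions.\<close>

lemma norm2_le_add:
  assumes "\<And>k. k < gdim m1 m2 \<Longrightarrow> vec_index W k = vec_index U k + vec_index V k"
  shows "norm2 P m1 m2 W \<le> norm2 P m1 m2 U + norm2 P m1 m2 V"
proof -
  have "L2_set (vec_index W) {..<gdim m1 m2}
      = L2_set (\<lambda>k. vec_index U k + vec_index V k) {..<gdim m1 m2}"
    using assms by (intro L2_set_cong) auto
  also have "\<dots> \<le> L2_set (vec_index U) {..<gdim m1 m2} + L2_set (vec_index V) {..<gdim m1 m2}"
    by (rule L2_set_triangle_ineq)
  finally have "L2_set (vec_index W) {..<gdim m1 m2}
    \<le> L2_set (vec_index U) {..<gdim m1 m2} + L2_set (vec_index V) {..<gdim m1 m2}" .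
  from mult_left_mono[OF this, of "sqrt (dx P m1 * dy P m2)"] dx_pos dy_pos show ?thesis
    by (simp add: norm2_L2_set algebra_simps less_imp_le)
qed

lemma grid_inner_gvec:
  "grid_inner P m1 m2 (gvec m1 m2 F) V
    = dx P m1 * dy P m2 * (\<Sum>i=0..int m1. \<Sum>j=0..int m2. F i j * zero_ext m1 m2 V i j)"
  unfolding grid_inner_def sum_over_grid[of "\<lambda>i j. F i j * zero_ext m1 m2 V i j", symmetric]
  by (rule arg_cong2[where f = "(*)", OF refl sum.cong[OF refl]])
    (simp only: index_gvec zero_ext_at_node lessThan_iff)

lemma norm2_square_zero_ext:
  "(norm2 P m1 m2 V)\<^sup>2
    = dx P m1 * dy P m2 * (\<Sum>i=0..int m1. \<Sum>j=0..int m2. (zero_ext m1 m2 V i j)\<^sup>2)"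
  unfolding norm2_square grid_inner_def
    sum_over_grid[of "\<lambda>i j. (zero_ext m1 m2 V i j)\<^sup>2", symmetric]
  by (intro arg_cong2[where f = "(*)"] sum.cong refl)
    (simp only: zero_ext_at_node lessThan_iff power2_eq_square)

lemma norm2_square_gvec:
  "(norm2 P m1 m2 (gvec m1 m2 F))\<^sup>2
    = dx P m1 * dy P m2 * (\<Sum>i=0..int m1. \<Sum>j=0..int m2. (F i j)\<^sup>2)"
  unfolding norm2_square grid_inner_def sum_over_grid[symmetric]
  by (intro arg_cong2[where f = "(*)"] sum.cong refl)
    (simp only: index_gvec lessThan_iff power2_eq_square)

lemma A_mat_mult_vec:
  assumes "V \<in> carrier_vec (gdim m1 m2)"
  shows "A_mat P m1 m2 *\<^sub>v V = gvec m1 m2 (A_formula P m1 m2 (zero_ext m1 m2 V))"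
  unfolding A_mat_def
proof (rule formula_mat_mult_vec[OF _ _ assms])
  show "A_formula P m1 m2 (\<lambda>i j. F i j + G i j) i j = A_formula P m1 m2 F i j + A_formula P m1 m2 G i j"
    for F G i j
    unfolding A_formula_def by (simp add: diff_divide_distrib add_divide_distrib algebra_simps)
  show "A_formula P m1 m2 (\<lambda>i j. c * F i j) i j = c * A_formula P m1 m2 F i j" for c F i j
    unfolding A_formula_def by (simp add: diff_divide_distrib add_divide_distrib algebra_simps)
qed

lemma B_mat_mult_vec:
  assumes "V \<in> carrier_vec (gdim m1 m2)"
  shows "B_mat P m1 m2 *\<^sub>v V = gvec m1 m2 (B_formula P m1 m2 (zero_ext m1 m2 V))"
  unfolding B_mat_def
proof (rule formula_mat_mult_vec[OF _ _ assms])
  show "B_formula P m1 m2 (\<lambda>i j. F i j + G i j) i j = B_formula P m1 m2 F i j + B_formula P m1 m2 G i j"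
    for F G i j
    by (simp add: B_formula_kernel algebra_simps sum.distrib)
  show "B_formula P m1 m2 (\<lambda>i j. c * F i j) i j = c * B_formula P m1 m2 F i j" for c F i j
    by (simp add: B_formula_kernel algebra_simps sum_distrib_left)
qed

text \<open>The bound on a single entry is the same for all \<open>j\<close>, so summing over
  \<open>j\<close> multiplies it by the number of nodes; together with \<open>dy P m2\<close> this
  is at most the length of the y-interval.\<close>

lemma norm2_B_mat_le:
  assumes "V \<in> carrier_vec (gdim m1 m2)"
  shows "norm2 P m1 m2 (B_mat P m1 m2 *\<^sub>v V)
    \<le> lam P * sqrt ((ymax P - ymin P) * sup_norm (dens P)) * norm2 P m1 m2 V"
proof (rule power2_le_imp_le)
  define U where "U = zero_ext m1 m2 V"
  define N where "N = (\<Sum>i=0..int m1. \<Sum>j=0..int m2. (U i j)\<^sup>2)"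
  have N0: "0 \<le> N" by (simp add: N_def sum_nonneg)
  let ?F = "sup_norm (dens P)" and ?L = "ymax P - ymin P"
  have "(norm2 P m1 m2 (B_mat P m1 m2 *\<^sub>v V))\<^sup>2
      = dx P m1 * dy P m2 * (\<Sum>i=0..int m1. \<Sum>j=0..int m2. (B_formula P m1 m2 U i j)\<^sup>2)"
    by (simp add: B_mat_mult_vec[OF assms] norm2_square_gvec U_def)
  also have "\<dots> \<le> dx P m1 * dy P m2 * (\<Sum>i=0..int m1. \<Sum>j=0..int m2.
      (lam P)\<^sup>2 * (?F * dy P m2 * (\<Sum>l=0..int m2. (U i l)\<^sup>2)))"
    using dx_pos[of m1] dy_pos[of m2]
    by (intro mult_left_mono sum_mono B_formula_square_le) (auto simp: U_def zero_ext_eq_0)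
  also have "\<dots> = dx P m1 * dy P m2 * ((lam P)\<^sup>2 * ?F * ((real m2 + 1) * dy P m2) * N)"
    by (simp add: N_def flip: sum_distrib_left)
  also have "\<dots> \<le> dx P m1 * dy P m2 * ((lam P)\<^sup>2 * ?F * ?L * N)"
  proof -
    \<comment> \<open>There are \<open>m2 + 1\<close> interior nodes but \<open>m2 + 2\<close>
      cells.\<close>
    have "(real m2 + 1) * dy P m2 \<le> ?L"
      using ylim by (simp add: dy_def field_simps)
    then show ?thesis using dx_pos[of m1] dy_pos[of m2] N0 sup_norm_nonneg
      by (intro mult_left_mono mult_right_mono) auto
  qed
  also have "\<dots> = (lam P * sqrt (?L * ?F) * norm2 P m1 m2 V)\<^sup>2"
    using ylim sup_norm_nonneg
    by (simp add: power_mult_distrib norm2_square_zero_ext N_def U_def)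
  finally show "(norm2 P m1 m2 (B_mat P m1 m2 *\<^sub>v V))\<^sup>2
    \<le> (lam P * sqrt (?L * ?F) * norm2 P m1 m2 V)\<^sup>2" .
  show "0 \<le> lam P * sqrt (?L * ?F) * norm2 P m1 m2 V"
    using lam_pos ylim sup_norm_nonneg norm2_nonneg by (auto intro!: mult_nonneg_nonneg)
qed

text \<open>Testing with \<open>V\<close> splits \<open>A_mat\<close> into one-dimensional sums
  along grid lines: diffusion contributes nothing positive and each drift direction its bound from
  \<open>advection_le\<close>.\<close>

lemma grid_inner_A_mat_le:
  assumes V: "V \<in> carrier_vec (gdim m1 m2)" and w: "weight_conditions (wt P)"
    and "0 \<le> alpha P" "0 \<le> beta P"
  shows "grid_inner P m1 m2 (A_mat P m1 m2 *\<^sub>v V) V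
    \<le> ((\<bar>wt P (-1)\<bar> - 10 * wt P 2) * (alpha P + beta P) - (rate P + lam P)) * (norm2 P m1 m2 V)\<^sup>2"
proof -
  define U where "U = zero_ext m1 m2 V"
  define N where "N = (\<Sum>i=0..int m1. \<Sum>j=0..int m2. (U i j)\<^sup>2)"
  let ?W = "\<bar>wt P (-1)\<bar> - 10 * wt P 2"
  have U0: "U i j = 0" if "i \<notin> {0..int m1} \<or> j \<notin> {0..int m2}" for i j
    using that by (simp add: U_def zero_ext_eq_0)
  define D where "D i j = U i j * (U (i - 1) j - 2 * U i j + U (i + 1) j)" for i j
  define X where "X i j = U i j *
      (pos_part (acoef P m1 i) * ((wt P 2 * U (i + 2) j + wt P 1 * U (i + 1) j + wt P 0 * U i j
           + wt P (-1) * U (i - 1) j) / dx P m1)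
     + neg_part (acoef P m1 i) * ((- wt P (-1) * U (i + 1) j - wt P 0 * U i j - wt P 1 * U (i - 1) j
           - wt P 2 * U (i - 2) j) / dx P m1))" for i j
  define Y where "Y i j = U i j *
      (pos_part (bcoef P m2 j) * ((wt P 2 * U i (j + 2) + wt P 1 * U i (j + 1) + wt P 0 * U i j
           + wt P (-1) * U i (j - 1)) / dy P m2)
     + neg_part (bcoef P m2 j) * ((- wt P (-1) * U i (j + 1) - wt P 0 * U i j - wt P 1 * U i (j - 1)
           - wt P 2 * U i (j - 2)) / dy P m2))" for i j
  have "A_formula P m1 m2 U i j * U i j
      = (vol P)\<^sup>2 / 2 / (dx P m1)\<^sup>2 * D i j - (rate P + lam P) * (U i j)\<^sup>2 + X i j + Y i j" for i j
    unfolding A_formula_def D_def X_def Y_def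
    by (simp add: algebra_simps power2_eq_square add_divide_distrib diff_divide_distrib)
  then have "(\<Sum>i=0..int m1. \<Sum>j=0..int m2. A_formula P m1 m2 U i j * U i j)
      = (vol P)\<^sup>2 / 2 / (dx P m1)\<^sup>2 * (\<Sum>i=0..int m1. \<Sum>j=0..int m2. D i j) - (rate P + lam P) * N
        + (\<Sum>i=0..int m1. \<Sum>j=0..int m2. X i j) + (\<Sum>i=0..int m1. \<Sum>j=0..int m2. Y i j)"
    by (simp only: N_def sum.distrib sum_subtractf sum_distrib_left)
  also have "\<dots> \<le> 0 - (rate P + lam P) * N + ?W * alpha P * N + ?W * beta P * N"
  proof (intro add_mono diff_mono order_refl)
    have "(\<Sum>i=0..int m1. \<Sum>j=0..int m2. D i j) = (\<Sum>j=0..int m2. \<Sum>i=0..int m1. D i j)"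
      by (rule sum.swap)
    also have "\<dots> \<le> 0"
      unfolding D_def using U0 by (intro sum_nonpos second_difference_nonpos) auto
    finally show "(vol P)\<^sup>2 / 2 / (dx P m1)\<^sup>2 * (\<Sum>i=0..int m1. \<Sum>j=0..int m2. D i j) \<le> 0"
      by (intro mult_nonneg_nonpos) auto
  next
    \<comment> \<open>The drift drops by \<open>alpha P * dx P m1\<close> per node, so the quotient
      \<open>\<eta> / h\<close> of \<open>advection_le\<close> equals \<open>alpha P\<close> on
      every mesh.\<close>
    have a: "acoef P m1 i - acoef P m1 (i + 1) = alpha P * dx P m1" for i
      using xnode_Suc[of m1 i] by (simp add: acoef_def flip: right_diff_distrib)
    have "(\<Sum>i=0..int m1. \<Sum>j=0..int m2. X i j) = (\<Sum>j=0..int m2. \<Sum>i=0..int m1. X i j)"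
      by (rule sum.swap)
    also have "\<dots> \<le> (\<Sum>j=0..int m2. ?W * (alpha P * dx P m1 / dx P m1) * (\<Sum>i=0..int m1. (U i j)\<^sup>2))"
      unfolding X_def using U0 a dx_pos[of m1] assms by (intro sum_mono advection_le) auto
    also have "\<dots> = ?W * alpha P * (\<Sum>j=0..int m2. \<Sum>i=0..int m1. (U i j)\<^sup>2)"
      using dx_pos[of m1] by (simp add: sum_distrib_left)
    also have "(\<Sum>j=0..int m2. \<Sum>i=0..int m1. (U i j)\<^sup>2) = N"
      unfolding N_def by (rule sum.swap)
    finally show "(\<Sum>i=0..int m1. \<Sum>j=0..int m2. X i j) \<le> ?W * alpha P * N" .
  next
    have b: "bcoef P m2 j - bcoef P m2 (j + 1) = beta P * dy P m2" for j
      using ynode_Suc[of m2 j] by (simp add: bcoef_def flip: right_diff_distrib)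
    have "(\<Sum>i=0..int m1. \<Sum>j=0..int m2. Y i j)
        \<le> (\<Sum>i=0..int m1. ?W * (beta P * dy P m2 / dy P m2) * (\<Sum>j=0..int m2. (U i j)\<^sup>2))"
      unfolding Y_def using U0 b dy_pos[of m2] assms by (intro sum_mono advection_le) auto
    also have "\<dots> = ?W * beta P * N"
      using dy_pos[of m2] by (simp add: sum_distrib_left N_def)
    finally show "(\<Sum>i=0..int m1. \<Sum>j=0..int m2. Y i j) \<le> ?W * beta P * N" .
  qed
  also have "\<dots> = (?W * (alpha P + beta P) - (rate P + lam P)) * N"
    by (simp add: algebra_simps)
  finally have "dx P m1 * dy P m2 * (\<Sum>i=0..int m1. \<Sum>j=0..int m2. A_formula P m1 m2 U i j * U i j)
      \<le> dx P m1 * dy P m2 * ((?W * (alpha P + beta P) - (rate P + lam P)) * N)"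
    using dx_pos[of m1] dy_pos[of m2] by (intro mult_left_mono) auto
  then show ?thesis
    by (simp add: A_mat_mult_vec[OF V] grid_inner_gvec norm2_square_zero_ext mult.left_commute
        flip: U_def N_def)
qed

text \<open>By Cauchy-Schwarz the norm bound for \<open>B_mat\<close> supplies the last summand of
  \<open>C_hat\<close>.\<close>

lemma grid_inner_AB_le:
  assumes V: "V \<in> carrier_vec (gdim m1 m2)" and "weight_conditions (wt P)"
    and "0 \<le> alpha P" "0 \<le> beta P"
  shows "grid_inner P m1 m2 (A_mat P m1 m2 *\<^sub>v V) V + grid_inner P m1 m2 (B_mat P m1 m2 *\<^sub>v V) V
    \<le> C_hat P * (norm2 P m1 m2 V)\<^sup>2"
proof -
  have "grid_inner P m1 m2 (B_mat P m1 m2 *\<^sub>v V) V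
      \<le> norm2 P m1 m2 (B_mat P m1 m2 *\<^sub>v V) * norm2 P m1 m2 V"
    using abs_grid_inner_le[of m1 m2 "B_mat P m1 m2 *\<^sub>v V" V] by simp
  also have "\<dots> \<le> lam P * sqrt ((ymax P - ymin P) * sup_norm (dens P)) * norm2 P m1 m2 V * norm2 P m1 m2 V"
    by (intro mult_right_mono norm2_B_mat_le V norm2_nonneg)
  finally show ?thesis
    using grid_inner_A_mat_le[OF assms] by (simp add: C_hat_def algebra_simps power2_eq_square)
qed

end

section \<open>Error propagation\<close>

text \<open>Three mean value estimates in turn: for the oscillation of \<open>f2\<close>, for a
  Taylor remainder of \<open>f1\<close>, and for the quadrature defect. The constant 1/2 is not
  sharp; only the cubic order matters.\<close>

lemma trapezoid_rule_error:
  fixes f0 f1 f2 f3 :: "real \<Rightarrow> real"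
  assumes d0: "\<And>x. x \<in> {a..b} \<Longrightarrow> (f0 has_real_derivative f1 x) (at x within {a..b})"
    and d1: "\<And>x. x \<in> {a..b} \<Longrightarrow> (f1 has_real_derivative f2 x) (at x within {a..b})"
    and d2: "\<And>x. x \<in> {a..b} \<Longrightarrow> (f2 has_real_derivative f3 x) (at x within {a..b})"
    and K: "\<And>x. x \<in> {a..b} \<Longrightarrow> \<bar>f3 x\<bar> \<le> K" and "a \<le> b"
  shows "\<bar>f0 b - f0 a - (b - a) / 2 * (f1 a + f1 b)\<bar> \<le> K * (b - a) ^ 3 / 2"
proof -
  let ?h = "b - a"
  have "0 \<le> K" using K[of a] \<open>a \<le> b\<close> by auto
  have f2: "\<bar>f2 z - f2 x\<bar> \<le> K * ?h" if "x \<in> {a..b}" "z \<in> {a..b}" for x z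
  proof -
    have "norm (f2 z - f2 x) \<le> K * norm (z - x)"
      by (rule field_differentiable_bound[of "{a..b}"]) (use that d2 K in auto)
    also have "\<dots> \<le> K * ?h" using that \<open>0 \<le> K\<close> by (intro mult_left_mono) auto
    finally show ?thesis by simp
  qed
  have f1: "\<bar>f1 x - f1 a - (x - a) * f2 x\<bar> \<le> K * ?h\<^sup>2" if x: "x \<in> {a..b}" for x
  proof -
    have "norm ((f1 x - x * f2 x) - (f1 a - a * f2 x)) \<le> (K * ?h) * norm (x - a)"
    proof (rule field_differentiable_bound[of "{a..b}" "\<lambda>z. f1 z - z * f2 x" "\<lambda>z. f2 z - f2 x"])
      show "((\<lambda>z. f1 z - z * f2 x) has_real_derivative f2 z - f2 x) (at z within {a..b})"
        if "z \<in> {a..b}" for z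
        using d1[OF that] by (auto intro!: derivative_eq_intros)
    qed (use x f2 \<open>a \<le> b\<close> in auto)
    also have "\<dots> \<le> (K * ?h) * ?h" using x \<open>0 \<le> K\<close> by (intro mult_left_mono) auto
    finally show ?thesis by (simp add: algebra_simps power2_eq_square)
  qed
  \<comment> \<open>The defect is viewed as a function of the right end point \<open>z\<close>. Its
    derivative is half the Taylor remainder just estimated.\<close>
  have "norm ((f0 b - (b - a) / 2 * (f1 a + f1 b)) - (f0 a - (a - a) / 2 * (f1 a + f1 a)))
      \<le> (K * ?h\<^sup>2 / 2) * norm (b - a)"
  proof (rule field_differentiable_bound[of "{a..b}" "\<lambda>z. f0 z - (z - a) / 2 * (f1 a + f1 z)"
        "\<lambda>z. (f1 z - f1 a - (z - a) * f2 z) / 2"])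
    show "((\<lambda>z. f0 z - (z - a) / 2 * (f1 a + f1 z)) has_real_derivative
        (f1 z - f1 a - (z - a) * f2 z) / 2) (at z within {a..b})" if "z \<in> {a..b}" for z
      using d0[OF that] d1[OF that] by (auto intro!: derivative_eq_intros simp: field_simps)
    show "norm ((f1 z - f1 a - (z - a) * f2 z) / 2) \<le> K * ?h\<^sup>2 / 2" if "z \<in> {a..b}" for z
      using f1[OF that] by simp
  qed (use \<open>a \<le> b\<close> in auto)
  then show ?thesis
    using \<open>a \<le> b\<close> by (simp add: algebra_simps power2_eq_square power3_eq_cube)
qed

text \<open>In the application \<open>a\<close> and \<open>b\<close> are the norms of the new and
  the old error, \<open>s\<close> is the norm of their sum, and \<open>c\<close> is the growth
  constant times the time step. Dividing by \<open>a + b\<close> makes the quadratic inequality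
  linear.\<close>

lemma energy_step:
  fixes a b s c \<tau> :: real
  assumes energy: "a\<^sup>2 - b\<^sup>2 \<le> c / 2 * s\<^sup>2 + \<tau> * s"
    and "0 \<le> a" "0 \<le> b" "0 \<le> s" "s \<le> a + b" "0 \<le> \<tau>" "0 \<le> c" "c \<le> 1"
  shows "a \<le> (1 + 2 * c) * b + 2 * \<tau>"
proof (cases "a + b = 0")
  case True
  then have "a = 0" "b = 0" using assms by linarith+
  then show ?thesis using assms by simp
next
  case False
  then have pos: "0 < a + b" using assms by linarith
  have "(a - b) * (a + b) = a\<^sup>2 - b\<^sup>2" by (simp add: power2_eq_square algebra_simps)
  also have "\<dots> \<le> c / 2 * (a + b)\<^sup>2 + \<tau> * (a + b)"
    using assms by (intro order_trans[OF energy] add_mono mult_left_mono power_mono) auto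
  also have "\<dots> = (c / 2 * (a + b) + \<tau>) * (a + b)"
    by (simp add: power2_eq_square algebra_simps)
  finally have "a - b \<le> c / 2 * (a + b) + \<tau>"
    using pos by simp
  then have "(1 - c / 2) * a \<le> (1 + c / 2) * b + \<tau>"
    by (simp add: algebra_simps add_divide_distrib)
  \<comment> \<open>The product \<open>(1 - c / 2) * (1 + 2 * c)\<close> exceeds
    \<open>1 + c / 2\<close> by \<open>c - c * c\<close>. This is where the restriction
    \<open>c \<le> 1\<close> on the time step enters.\<close>
  also have "\<dots> \<le> (1 - c / 2) * (1 + 2 * c) * b + (1 - c / 2) * 2 * \<tau>"
  proof (intro add_mono mult_right_mono)
    have "c * c \<le> c * 1" using assms by (intro mult_left_mono) auto
    then show "1 + c / 2 \<le> (1 - c / 2) * (1 + 2 * c)" by (simp add: algebra_simps)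
    have "1 * \<tau> \<le> ((1 - c / 2) * 2) * \<tau>" using assms by (intro mult_right_mono) auto
    then show "\<tau> \<le> (1 - c / 2) * 2 * \<tau>" by simp
  qed (use assms in auto)
  also have "\<dots> = (1 - c / 2) * ((1 + 2 * c) * b + 2 * \<tau>)"
    by (simp add: algebra_simps)
  finally show ?thesis using assms by simp
qed

text \<open>Since \<open>1 + c \<le> exp c\<close>, each of the \<open>n\<close> contributions
  \<open>d\<close> is amplified by at most \<open>exp (c * real n)\<close>.\<close>

lemma discrete_gronwall:
  fixes a :: "nat \<Rightarrow> real"
  assumes "a 0 = 0" and "\<And>k. k < n \<Longrightarrow> a (Suc k) \<le> (1 + c) * a k + d" and "0 \<le> c" "0 \<le> d"
  shows "a n \<le> real n * d * exp (c * real n)"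
  using assms(2)
proof (induction n)
  case (Suc n)
  have "a (Suc n) \<le> (1 + c) * a n + d" by (rule Suc.prems) simp
  also have "\<dots> \<le> exp c * (real n * d * exp (c * real n)) + d * exp (c * real (Suc n))"
  proof (rule add_mono)
    have "(1 + c) * a n \<le> (1 + c) * (real n * d * exp (c * real n))"
      using Suc assms by (intro mult_left_mono) auto
    also have "\<dots> \<le> exp c * (real n * d * exp (c * real n))"
      using assms by (intro mult_right_mono exp_ge_add_one_self) auto
    finally show "(1 + c) * a n \<le> exp c * (real n * d * exp (c * real n))" .
    have "d * 1 \<le> d * exp (c * real (Suc n))"
      using assms by (intro mult_left_mono) auto
    then show "d \<le> d * exp (c * real (Suc n))" by simp
  qed
  also have "\<dots> = real (Suc n) * d * exp (c * real (Suc n))"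
    by (simp add: algebra_simps exp_add)
  finally show ?case .
qed (simp add: assms)

lemma smult_mat_mult_vec:
  fixes A :: "'a::comm_ring mat"
  assumes "A \<in> carrier_mat nr nc" "x \<in> carrier_vec nc"
  shows "(c \<cdot>\<^sub>m A) *\<^sub>v x = c \<cdot>\<^sub>v (A *\<^sub>v x)"
  using assms by (intro eq_vecI) auto

lemma dim_vec_ddt_iterate: "dim_vec ((ddt T ^^ p) u t) = dim_vec (u t)"
  by (induction p) (auto simp: ddt_def)

text \<open>\<open>vector_derivative\<close> is meaningful only where a derivative exists;
  \<open>Ck_vec\<close> guarantees this for the orders below \<open>q\<close>.\<close>

lemma ddt_iterate_has_derivative:
  assumes "Ck_vec N q T u" and "p < q" "k < N" "t \<in> {0..T}" "dim_vec (u t) = N"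
  shows "((\<lambda>s. vec_index ((ddt T ^^ p) u s) k) has_real_derivative vec_index ((ddt T ^^ Suc p) u t) k)
    (at t within {0..T})"
proof -
  have "(\<lambda>s. vec_index ((ddt T ^^ p) u s) k) differentiable (at t within {0..T})"
    using assms unfolding Ck_vec_def differentiable_on_def by blast
  then show ?thesis
    using assms
    by (simp add: ddt_def dim_vec_ddt_iterate vector_derivative_works
        has_real_derivative_iff_has_vector_derivative)
qed

section \<open>Truncation error, one time step, and accumulation of the error\<close>

context jump_problem
begin

text \<open>The scalar estimate is applied to the inner product of the path with the defect
  \<open>\<rho>\<close> itself. Its quadrature error is the squared norm of \<open>\<rho>\<close>,
  and cancelling one factor gives the scalar constant regardless of the dimension.\<close>

lemma trapezoid_rule_error_vec:
  assumes C3: "Ck_vec (gdim m1 m2) 3 T u" and dim: "\<And>t. dim_vec (u t) = gdim m1 m2"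
    and M: "\<And>t. t \<in> {0..T} \<Longrightarrow> norm2 P m1 m2 ((ddt T ^^ 3) u t) \<le> M"
    and ab: "0 \<le> a" "a \<le> b" "b \<le> T"
    and \<rho>: "\<And>k. k < gdim m1 m2 \<Longrightarrow> vec_index \<rho> k = vec_index (u b) k - vec_index (u a) k
      - (b - a) / 2 * (vec_index (ddt T u a) k + vec_index (ddt T u b) k)"
  shows "norm2 P m1 m2 \<rho> \<le> M * (b - a) ^ 3 / 2"
proof -
  define \<phi> where "\<phi> p t = grid_inner P m1 m2 \<rho> ((ddt T ^^ p) u t)" for p t
  have deriv: "(\<phi> p has_real_derivative \<phi> (Suc p) t) (at t within {a..b})"
    if "t \<in> {a..b}" "p < 3" for p t
  proof (rule DERIV_subset)
    show "(\<phi> p has_real_derivative \<phi> (Suc p) t) (at t within {0..T})"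
      unfolding \<phi>_def grid_inner_def
      by (intro DERIV_cmult DERIV_sum ddt_iterate_has_derivative[OF C3 \<open>p < 3\<close>])
        (use that ab dim in auto)
  qed (use ab in auto)
  have bound: "\<bar>\<phi> 3 t\<bar> \<le> norm2 P m1 m2 \<rho> * M" if "t \<in> {a..b}" for t
    unfolding \<phi>_def using that ab
    by (intro order_trans[OF abs_grid_inner_le] mult_left_mono M norm2_nonneg) auto
  have "(norm2 P m1 m2 \<rho>)\<^sup>2 = \<phi> 0 b - \<phi> 0 a - (b - a) / 2 * (\<phi> 1 a + \<phi> 1 b)"
  proof -
    have "(\<Sum>k<gdim m1 m2. vec_index \<rho> k * vec_index \<rho> k)
        = (\<Sum>k<gdim m1 m2. vec_index \<rho> k * vec_index (u b) k - vec_index \<rho> k * vec_index (u a) k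
          - (b - a) / 2 * (vec_index \<rho> k * vec_index (ddt T u a) k + vec_index \<rho> k * vec_index (ddt T u b) k))"
    proof (intro sum.cong refl)
      fix k assume "k \<in> {..<gdim m1 m2}"
      from \<rho>[of k] this show "vec_index \<rho> k * vec_index \<rho> k
        = vec_index \<rho> k * vec_index (u b) k - vec_index \<rho> k * vec_index (u a) k
          - (b - a) / 2 * (vec_index \<rho> k * vec_index (ddt T u a) k + vec_index \<rho> k * vec_index (ddt T u b) k)"
        by (metis (no_types, lifting) lessThan_iff distrib_left mult.left_commute right_diff_distrib)
    qed
    then have "(\<Sum>k<gdim m1 m2. vec_index \<rho> k * vec_index \<rho> k)
        = (\<Sum>k<gdim m1 m2. vec_index \<rho> k * vec_index (u b) k) - (\<Sum>k<gdim m1 m2. vec_index \<rho> k * vec_index (u a) k)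
          - (b - a) / 2 * ((\<Sum>k<gdim m1 m2. vec_index \<rho> k * vec_index (ddt T u a) k)
            + (\<Sum>k<gdim m1 m2. vec_index \<rho> k * vec_index (ddt T u b) k))"
      by (simp only: sum_subtractf sum.distrib sum_distrib_left[symmetric])
    from arg_cong[OF this, of "\<lambda>x. dx P m1 * dy P m2 * x"] show ?thesis
      unfolding norm2_square \<phi>_def grid_inner_def by (simp add: algebra_simps)
  qed
  also have "\<dots> \<le> norm2 P m1 m2 \<rho> * M * (b - a) ^ 3 / 2"
  proof (rule abs_le_D1, rule trapezoid_rule_error)
    show "(\<phi> 0 has_real_derivative \<phi> 1 t) (at t within {a..b})"
      "(\<phi> 1 has_real_derivative \<phi> 2 t) (at t within {a..b})"
      "(\<phi> 2 has_real_derivative \<phi> 3 t) (at t within {a..b})" if "t \<in> {a..b}" for t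
      using deriv[OF that, of 0] deriv[OF that, of 1] deriv[OF that, of 2]
      by (simp_all add: numeral_2_eq_2 numeral_3_eq_3)
  qed (use bound ab in auto)
  finally have "norm2 P m1 m2 \<rho> * norm2 P m1 m2 \<rho> \<le> norm2 P m1 m2 \<rho> * (M * (b - a) ^ 3 / 2)"
    by (simp add: power2_eq_square)
  \<comment> \<open>When the norm of \<open>\<rho>\<close> is 0 no factor can be cancelled;
    nonnegativity of \<open>M\<close> settles that case.\<close>
  moreover have "0 \<le> M" using M[of a] norm2_nonneg[of m1 m2 "(ddt T ^^ 3) u a"] ab by auto
  ultimately show ?thesis
    using norm2_nonneg[of m1 m2 \<rho>] ab by (cases "norm2 P m1 m2 \<rho> = 0") auto
qed

lemma norm2_smult:
  assumes "\<And>k. k < gdim m1 m2 \<Longrightarrow> vec_index W k = c * vec_index V k"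
  shows "norm2 P m1 m2 W = \<bar>c\<bar> * norm2 P m1 m2 V"
proof -
  have "grid_inner P m1 m2 W W = c\<^sup>2 * grid_inner P m1 m2 V V"
    unfolding grid_inner_def using assms
    by (simp add: sum_distrib_left power2_eq_square algebra_simps)
  then show ?thesis by (simp add: norm2_def real_sqrt_mult)
qed

text \<open>The error equation is tested with the sum of two consecutive errors. \<open>C\<close> is
  a nonnegative bound for \<open>C_hat\<close>, whose sign is not known.\<close>

lemma crank_nicolson_error_step:
  assumes w: "weight_conditions (wt P)" and ab: "0 \<le> alpha P" "0 \<le> beta P"
    and C3: "Ck_vec (gdim m1 m2) 3 T (exact_vec P v m1 m2)"
    and M: "\<And>t. t \<in> {0..T} \<Longrightarrow> norm2 P m1 m2 ((ddt T ^^ 3) (exact_vec P v m1 m2) t) \<le> M"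
    and D: "\<And>t. t \<in> {0..T} \<Longrightarrow> norm2 P m1 m2 (spatial_error P v T m1 m2 t) \<le> D"
    and cn: "crank_nicolson P v m1 m2 dt V"
    and dt: "0 < dt" "real (Suc n) * dt \<le> T"
    and C: "C_hat P \<le> C" "0 \<le> C" "C * dt \<le> 1"
  shows "norm2 P m1 m2 (global_error P v m1 m2 dt V (Suc n))
    \<le> (1 + 2 * (C * dt)) * norm2 P m1 m2 (global_error P v m1 m2 dt V n)
      + 2 * (M * dt ^ 3 / 2 + dt * D)"
proof -
  let ?N = "gdim m1 m2" and ?A = "A_mat P m1 m2" and ?B = "B_mat P m1 m2" and ?u = "exact_vec P v m1 m2"
  let ?nrm = "norm2 P m1 m2"
  define t t' where "t = real n * dt" and "t' = real (Suc n) * dt"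
  have t: "0 \<le> t" "t \<le> t'" "t' \<le> T" "t' - t = dt" "t \<in> {0..T}" "t' \<in> {0..T}"
    using dt by (auto simp: t_def t'_def algebra_simps)
  define e e' where "e = global_error P v m1 m2 dt V n" and "e' = global_error P v m1 m2 dt V (Suc n)"
  define s where "s = e + e'"
  define \<rho> where "\<rho> = vec ?N (\<lambda>k. vec_index (?u t') k - vec_index (?u t) k
      - dt / 2 * (vec_index (ddt T ?u t) k + vec_index (ddt T ?u t') k))"
  define \<delta> where "\<delta> = vec ?N (\<lambda>k. vec_index (spatial_error P v T m1 m2 t) k
      + vec_index (spatial_error P v T m1 m2 t') k)"
  \<comment> \<open>The truncation error: the trapezoidal defect in time plus the time step times
    the mean of the two spatial errors.\<close>
  define \<tau> where "\<tau> = \<rho> + (dt / 2) \<cdot>\<^sub>v \<delta>"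
  have A: "?A \<in> carrier_mat ?N ?N" and B: "?B \<in> carrier_mat ?N ?N"
    by (simp_all add: A_mat_def B_mat_def formula_mat_carrier)
  have u: "?u r \<in> carrier_vec ?N" for r by (simp add: exact_vec_def gvec_carrier)
  have Vc: "V n \<in> carrier_vec ?N" "V (Suc n) \<in> carrier_vec ?N"
    using cn by (simp_all add: crank_nicolson_def Let_def)
  have ec: "e \<in> carrier_vec ?N" "e' \<in> carrier_vec ?N" "s \<in> carrier_vec ?N"
    using u Vc by (auto simp: e_def e'_def s_def global_error_def)
  have g: "g_vec P m1 m2 r \<in> carrier_vec ?N" for r
    by (simp add: g_vec_def gvec_carrier)
  \<comment> \<open>Subtracting the scheme from the relation satisfied by the exact values cancels
    the boundary vectors and leaves the operator applied to \<open>s\<close>.\<close>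
  have entry: "vec_index e' k - vec_index e k
      = dt / 2 * (vec_index (?A *\<^sub>v s) k + vec_index (?B *\<^sub>v s) k) + vec_index \<tau> k"
    if k: "k < ?N" for k
  proof -
    have lin: "vec_index (X *\<^sub>v s) k = vec_index (X *\<^sub>v ?u t) k + vec_index (X *\<^sub>v ?u t') k
        - vec_index (X *\<^sub>v V n) k - vec_index (X *\<^sub>v V (Suc n)) k" if X: "X \<in> carrier_mat ?N ?N" for X
    proof -
      have "X *\<^sub>v s = (X *\<^sub>v ?u t - X *\<^sub>v V n) + (X *\<^sub>v ?u t' - X *\<^sub>v V (Suc n))"
        unfolding s_def e_def e'_def global_error_def t_def t'_def
        using X u Vc by (simp add: mult_add_distrib_mat_vec[of _ ?N ?N]
            mult_minus_distrib_mat_vec[of _ ?N ?N])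
      then show ?thesis using X k by simp
    qed
    have scheme: "vec_index (V (Suc n)) k - dt / 2 * vec_index (?A *\<^sub>v V (Suc n)) k
        = vec_index (V n) k + dt / 2 * vec_index (?A *\<^sub>v V n) k
          + dt / 2 * (vec_index (?B *\<^sub>v V n) k + vec_index (?B *\<^sub>v V (Suc n)) k)
          + dt / 2 * (vec_index (g_vec P m1 m2 t) k + vec_index (g_vec P m1 m2 t') k)"
    proof -
      have "(1\<^sub>m ?N - (dt / 2) \<cdot>\<^sub>m ?A) *\<^sub>v V (Suc n) = V (Suc n) - (dt / 2) \<cdot>\<^sub>v (?A *\<^sub>v V (Suc n))"
        and "(1\<^sub>m ?N + (dt / 2) \<cdot>\<^sub>m ?A) *\<^sub>v V n = V n + (dt / 2) \<cdot>\<^sub>v (?A *\<^sub>v V n)"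
        using A Vc by (simp_all add: minus_mult_distrib_mat_vec[of _ ?N ?N]
            add_mult_distrib_mat_vec[of _ ?N ?N] smult_mat_mult_vec[of _ ?N ?N])
      moreover have "(1\<^sub>m ?N - (dt / 2) \<cdot>\<^sub>m ?A) *\<^sub>v V (Suc n)
          = (1\<^sub>m ?N + (dt / 2) \<cdot>\<^sub>m ?A) *\<^sub>v V n + (dt / 2) \<cdot>\<^sub>v (?B *\<^sub>v V n + ?B *\<^sub>v V (Suc n))
            + (dt / 2) \<cdot>\<^sub>v (g_vec P m1 m2 t + g_vec P m1 m2 t')"
        using cn by (simp add: crank_nicolson_def Let_def t_def t'_def)
      ultimately have "V (Suc n) - (dt / 2) \<cdot>\<^sub>v (?A *\<^sub>v V (Suc n))
          = V n + (dt / 2) \<cdot>\<^sub>v (?A *\<^sub>v V n) + (dt / 2) \<cdot>\<^sub>v (?B *\<^sub>v V n + ?B *\<^sub>v V (Suc n))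
            + (dt / 2) \<cdot>\<^sub>v (g_vec P m1 m2 t + g_vec P m1 m2 t')" by simp
      from arg_cong[OF this, of "\<lambda>x. vec_index x k"] show ?thesis
        using k A B Vc g[of t] g[of t'] by simp
    qed
    have se: "vec_index (spatial_error P v T m1 m2 r) k = vec_index (ddt T ?u r) k
        - (vec_index (?A *\<^sub>v ?u r) k + vec_index (?B *\<^sub>v ?u r) k) - vec_index (g_vec P m1 m2 r) k" for r
      unfolding spatial_error_def using k A B u[of r] g[of r]
      by (simp add: add_mult_distrib_mat_vec[of _ ?N ?N] ddt_def)
    have "vec_index e k = vec_index (?u t) k - vec_index (V n) k"
      "vec_index e' k = vec_index (?u t') k - vec_index (V (Suc n)) k"
      unfolding e_def e'_def global_error_def t_def t'_def using k u Vc by simp_all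
    moreover have "vec_index \<tau> k = vec_index (?u t') k - vec_index (?u t) k
      - dt / 2 * (vec_index (ddt T ?u t) k + vec_index (ddt T ?u t') k)
      + dt / 2 * (vec_index (spatial_error P v T m1 m2 t) k + vec_index (spatial_error P v T m1 m2 t') k)"
      using k by (simp add: \<tau>_def \<rho>_def \<delta>_def)
    ultimately show ?thesis
      using scheme unfolding lin[OF A] lin[OF B] se
        by (simp add: algebra_simps add_divide_distrib diff_divide_distrib)
  qed
  \<comment> \<open>Entrywise, the difference of squares is \<open>e' - e\<close> times
    \<open>s\<close>, and \<open>e' - e\<close> is given by \<open>entry\<close>.\<close>
  have "(?nrm e')\<^sup>2 - (?nrm e)\<^sup>2 = dt / 2 * (grid_inner P m1 m2 (?A *\<^sub>v s) s + grid_inner P m1 m2 (?B *\<^sub>v s) s)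
      + grid_inner P m1 m2 \<tau> s"
  proof -
    have "(\<Sum>k<?N. vec_index e' k * vec_index e' k - vec_index e k * vec_index e k)
        = (\<Sum>k<?N. dt / 2 * (vec_index (?A *\<^sub>v s) k * vec_index s k + vec_index (?B *\<^sub>v s) k * vec_index s k)
          + vec_index \<tau> k * vec_index s k)"
    proof (intro sum.cong refl)
      fix k assume "k \<in> {..<?N}"
      then have k: "k < ?N" by simp
      have "vec_index e' k * vec_index e' k - vec_index e k * vec_index e k
          = (vec_index e' k - vec_index e k) * vec_index s k"
        using k ec by (simp add: s_def algebra_simps)
      then show "vec_index e' k * vec_index e' k - vec_index e k * vec_index e k
        = dt / 2 * (vec_index (?A *\<^sub>v s) k * vec_index s k + vec_index (?B *\<^sub>v s) k * vec_index s k)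
          + vec_index \<tau> k * vec_index s k"
        unfolding entry[OF k] by (simp add: algebra_simps)
    qed
    then have "(\<Sum>k<?N. vec_index e' k * vec_index e' k) - (\<Sum>k<?N. vec_index e k * vec_index e k)
        = dt / 2 * ((\<Sum>k<?N. vec_index (?A *\<^sub>v s) k * vec_index s k) + (\<Sum>k<?N. vec_index (?B *\<^sub>v s) k * vec_index s k))
          + (\<Sum>k<?N. vec_index \<tau> k * vec_index s k)"
      by (simp only: sum_subtractf sum.distrib sum_distrib_left[symmetric])
    from arg_cong[OF this, of "\<lambda>x. dx P m1 * dy P m2 * x"] show ?thesis
      unfolding norm2_square grid_inner_def by (simp add: algebra_simps)
  qed
  also have "\<dots> \<le> dt / 2 * (C * (?nrm s)\<^sup>2) + ?nrm \<tau> * ?nrm s"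
  proof (intro add_mono mult_left_mono)
    show "grid_inner P m1 m2 (?A *\<^sub>v s) s + grid_inner P m1 m2 (?B *\<^sub>v s) s \<le> C * (?nrm s)\<^sup>2"
      using grid_inner_AB_le[OF ec(3) w ab] mult_right_mono[OF C(1), of "(?nrm s)\<^sup>2"] by simp
    show "grid_inner P m1 m2 \<tau> s \<le> ?nrm \<tau> * ?nrm s"
      using abs_grid_inner_le[of m1 m2 \<tau> s] by simp
  qed (use dt in auto)
  finally have "?nrm e' \<le> (1 + 2 * (C * dt)) * ?nrm e + 2 * ?nrm \<tau>"
  proof (intro energy_step[where s = "?nrm s"])
    show "?nrm s \<le> ?nrm e' + ?nrm e"
      by (rule norm2_le_add) (use ec in \<open>simp add: s_def\<close>)
  qed (use C dt norm2_nonneg in \<open>auto simp: algebra_simps\<close>)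
  moreover have "?nrm \<tau> \<le> M * dt ^ 3 / 2 + dt * D"
  proof -
    have "?nrm \<rho> \<le> M * (t' - t) ^ 3 / 2"
      by (rule trapezoid_rule_error_vec[OF C3 _ M t(1-3)])
        (use u carrier_vecD in \<open>auto simp: \<rho>_def t(4)\<close>)
    moreover have "?nrm ((dt / 2) \<cdot>\<^sub>v \<delta>) \<le> dt * D"
    proof -
      have "?nrm \<delta> \<le> ?nrm (spatial_error P v T m1 m2 t) + ?nrm (spatial_error P v T m1 m2 t')"
        by (rule norm2_le_add) (simp add: \<delta>_def)
      also have "\<dots> \<le> 2 * D" using D[OF t(5)] D[OF t(6)] by simp
      finally have \<delta>: "?nrm \<delta> \<le> 2 * D" .
      have "?nrm ((dt / 2) \<cdot>\<^sub>v \<delta>) = \<bar>dt / 2\<bar> * ?nrm \<delta>"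
        by (rule norm2_smult) (simp add: \<delta>_def)
      also have "\<dots> \<le> \<bar>dt / 2\<bar> * (2 * D)" by (intro mult_left_mono \<delta>) auto
      also have "\<dots> = dt * D" using dt by simp
      finally show ?thesis .
    qed
    moreover have "?nrm \<tau> \<le> ?nrm \<rho> + ?nrm ((dt / 2) \<cdot>\<^sub>v \<delta>)"
      by (rule norm2_le_add) (simp add: \<tau>_def \<delta>_def)
    ultimately show ?thesis unfolding t(4) by linarith
  qed
  ultimately show ?thesis by (simp add: e_def e'_def)
qed

text \<open>Gronwall from zero initial error. Each step adds a multiple of \<open>dt\<close>, and
  \<open>real n * dt \<le> T\<close> removes the dependence on the number of steps.\<close>

lemma crank_nicolson_error_le:
  assumes w: "weight_conditions (wt P)" and ab: "0 \<le> alpha P" "0 \<le> beta P"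
    and C3: "Ck_vec (gdim m1 m2) 3 T (exact_vec P v m1 m2)"
    and M: "\<And>t. t \<in> {0..T} \<Longrightarrow> norm2 P m1 m2 ((ddt T ^^ 3) (exact_vec P v m1 m2) t) \<le> M"
    and D: "\<And>t. t \<in> {0..T} \<Longrightarrow> norm2 P m1 m2 (spatial_error P v T m1 m2 t) \<le> D"
    and cn: "crank_nicolson P v m1 m2 dt V"
    and dt: "0 < dt" "real n * dt \<le> T"
    and C: "C_hat P \<le> C" "0 \<le> C" "C * dt \<le> 1" and "0 \<le> M" "0 \<le> D"
  shows "norm2 P m1 m2 (global_error P v m1 m2 dt V n) \<le> T * (M * dt\<^sup>2 + 2 * D) * exp (2 * C * T)"
proof -
  let ?e = "\<lambda>k. norm2 P m1 m2 (global_error P v m1 m2 dt V k)"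
  have "?e n \<le> real n * (2 * (M * dt ^ 3 / 2 + dt * D)) * exp (2 * (C * dt) * real n)"
  proof (rule discrete_gronwall)
    have "V 0 = exact_vec P v m1 m2 0"
      using cn by (simp add: crank_nicolson_def Let_def)
    \<comment> \<open>The initial error vanishes entrywise, so it is 0 times any vector, and
      \<open>norm2_smult\<close> applies.\<close>
    then have "?e 0 = \<bar>0\<bar> * norm2 P m1 m2 (V 0)"
      by (intro norm2_smult) (simp add: global_error_def exact_vec_def gvec_def)
    then show "?e 0 = 0" by simp
    show "?e (Suc k) \<le> (1 + 2 * (C * dt)) * ?e k + 2 * (M * dt ^ 3 / 2 + dt * D)" if "k < n" for k
    proof -
      have "real (Suc k) * dt \<le> real n * dt" using that dt by (intro mult_right_mono) auto
      with dt(2) have "real (Suc k) * dt \<le> T" by linarith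
      then show ?thesis
        using dt by (intro crank_nicolson_error_step[OF w ab C3 M D cn _ _ C]) auto
    qed
  qed (use assms in auto)
  also have "\<dots> = (real n * dt) * (M * dt\<^sup>2 + 2 * D) * exp (2 * C * (real n * dt))"
    by (simp add: algebra_simps power2_eq_square power3_eq_cube)
  also have "\<dots> \<le> T * (M * dt\<^sup>2 + 2 * D) * exp (2 * C * T)"
  proof -
    have "0 \<le> real n * dt" using dt by simp
    then have "0 \<le> T" using dt(2) by linarith
    then show ?thesis
      using dt(2) C(2) \<open>0 \<le> M\<close> \<open>0 \<le> D\<close> by (intro mult_mono mult_right_mono) (auto intro: mult_left_mono)
  qed
  finally show ?thesis .
qed

end

section \<open>The mesh-independent error constant and the passage to the limit\<close>

theorem theorem7:
  fixes P :: problem and v :: "real \<Rightarrow> real \<Rightarrow> real \<Rightarrow> real" and T :: real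
  assumes "alpha P > 0" and "beta P > 0" and "vol P > 0" and "lam P > 0"
    and "xmin P < xmax P" and "ymin P < ymax P"
    and "bounded_prob_density (dens P)"
    and "weight_conditions (wt P)"
    and "exact_solution P v"
    and "T > 0"
    and smooth:
      "\<And>m1 m2. admissible_grid P m1 m2 \<Longrightarrow> Ck_vec (gdim m1 m2) 3 T (exact_vec P v m1 m2)"
    and smooth_bound:
      "\<exists>M. \<forall>m1 m2. admissible_grid P m1 m2 \<longrightarrow>
         (\<forall>t\<in>{0..T}. norm2 P m1 m2 ((ddt T ^^ 3) (exact_vec P v m1 m2) t) \<le> M)"
    and consistency:
      "\<exists>C1>0. \<forall>m1 m2. admissible_grid P m1 m2 \<longrightarrow>
         (\<forall>t\<in>{0..T}. norm2 P m1 m2 (spatial_error P v T m1 m2 t)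
            \<le> C1 * ((dx P m1)\<^sup>2 + (dy P m2)\<^sup>2))"
  shows "convergent_CN P v T \<and>
    (\<exists>C>0. \<forall>m1 m2 dt V n.
       admissible_grid P m1 m2 \<and> 0 < dt \<and> crank_nicolson P v m1 m2 dt V \<and>
       real n * dt \<le> T \<and> C_hat P * dt \<le> 1
       \<longrightarrow> norm2 P m1 m2 (global_error P v m1 m2 dt V n)
             \<le> C * (dt\<^sup>2 + (dx P m1)\<^sup>2 + (dy P m2)\<^sup>2))"
proof -
  interpret jump_problem P
    using assms by unfold_locales
  \<comment> \<open>The absolute value makes the bound nonnegative, as the error estimate
    requires.\<close>
  obtain M where M: "norm2 P m1 m2 ((ddt T ^^ 3) (exact_vec P v m1 m2) t) \<le> \<bar>M\<bar>"
    if "admissible_grid P m1 m2" "t \<in> {0..T}" for m1 m2 t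
    using smooth_bound by (meson abs_ge_self order_trans)
  obtain C1 where C1: "0 < C1" "\<And>m1 m2 t. admissible_grid P m1 m2 \<Longrightarrow> t \<in> {0..T} \<Longrightarrow>
      norm2 P m1 m2 (spatial_error P v T m1 m2 t) \<le> C1 * ((dx P m1)\<^sup>2 + (dy P m2)\<^sup>2)"
    using consistency by blast
  \<comment> \<open>\<open>C_hat\<close> may be negative. For positive \<open>dt\<close>, replacing
    it by \<open>c\<close> does not strengthen the restriction on the time step.\<close>
  define c where "c = max (C_hat P) 0"
  define C where "C = T * (\<bar>M\<bar> + 2 * C1) * exp (2 * c * T)"
  have "0 < C" using \<open>T > 0\<close> C1(1) by (simp add: C_def add_nonneg_pos)
  have error: "norm2 P m1 m2 (global_error P v m1 m2 dt V n) \<le> C * (dt\<^sup>2 + (dx P m1)\<^sup>2 + (dy P m2)\<^sup>2)"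
    if adm: "admissible_grid P m1 m2" and dt: "0 < dt" and cn: "crank_nicolson P v m1 m2 dt V"
      and n: "real n * dt \<le> T" and Cdt: "C_hat P * dt \<le> 1" for m1 m2 dt V n
  proof -
    let ?H = "(dx P m1)\<^sup>2 + (dy P m2)\<^sup>2"
    have "c * dt \<le> 1" using dt Cdt by (auto simp: c_def max_def)
    then have "norm2 P m1 m2 (global_error P v m1 m2 dt V n)
        \<le> T * (\<bar>M\<bar> * dt\<^sup>2 + 2 * (C1 * ?H)) * exp (2 * c * T)"
      using assms(1,2,8) smooth[OF adm] M[OF adm] C1(1) C1(2)[OF adm] cn dt n
      by (intro crank_nicolson_error_le) (auto simp: c_def)
    also have "\<dots> \<le> T * ((\<bar>M\<bar> + 2 * C1) * (dt\<^sup>2 + ?H)) * exp (2 * c * T)"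
    proof (intro mult_left_mono mult_right_mono)
      have "0 \<le> \<bar>M\<bar> * ?H" "0 \<le> C1 * dt\<^sup>2" using C1(1) by (auto intro!: mult_nonneg_nonneg)
      then show "\<bar>M\<bar> * dt\<^sup>2 + 2 * (C1 * ?H) \<le> (\<bar>M\<bar> + 2 * C1) * (dt\<^sup>2 + ?H)"
        by (simp add: algebra_simps)
    qed (use \<open>T > 0\<close> in auto)
    finally show ?thesis by (simp add: C_def algebra_simps)
  qed
  have "convergent_CN P v T"
    unfolding convergent_CN_def
  proof (intro allI impI)
    fix \<epsilon> :: real assume "0 < \<epsilon>"
    \<comment> \<open>The bound 1 makes squared widths smaller than \<open>d\<close>;
      \<open>1 / (c + 1)\<close>, with a positive denominator even for \<open>c = 0\<close>,
      enforces the step restriction; \<open>\<epsilon> / (3 * C)\<close> shares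
      \<open>\<epsilon>\<close> among the three error terms.\<close>
    define d where "d = min 1 (min (1 / (c + 1)) (\<epsilon> / (3 * C)))"
    have "0 \<le> c" by (simp add: c_def)
    then have d: "0 < d" "d \<le> 1" "d \<le> 1 / (c + 1)" "d \<le> \<epsilon> / (3 * C)"
      using \<open>0 < \<epsilon>\<close> \<open>0 < C\<close> by (auto simp: d_def)
    show "\<exists>d>0. \<forall>m1 m2 dt V n.
        admissible_grid P m1 m2 \<and> dx P m1 < d \<and> dy P m2 < d \<and> 0 < dt \<and> dt < d \<and>
        crank_nicolson P v m1 m2 dt V \<and> real n * dt \<le> T
        \<longrightarrow> norm2 P m1 m2 (global_error P v m1 m2 dt V n) < \<epsilon>"
    proof (intro exI[of _ d] conjI allI impI d(1), elim conjE)
      fix m1 m2 dt V n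
      assume adm: "admissible_grid P m1 m2" and h: "dx P m1 < d" "dy P m2 < d" "0 < dt" "dt < d"
        and cn: "crank_nicolson P v m1 m2 dt V" and n: "real n * dt \<le> T"
      have sq: "x\<^sup>2 < d" if "0 < x" "x < d" for x :: real
      proof -
        have "x * x \<le> x * 1" using that d(2) by (intro mult_left_mono) auto
        with that(2) have "x * x < d" by linarith
        then show ?thesis by (simp add: power2_eq_square)
      qed
      have "C_hat P * dt \<le> (c + 1) * dt"
        using h(3) by (intro mult_right_mono) (auto simp: c_def)
      also have "\<dots> \<le> (c + 1) * (1 / (c + 1))"
        using h(4) d(3) \<open>0 \<le> c\<close> by (intro mult_left_mono) auto
      also have "\<dots> = 1" using \<open>0 \<le> c\<close> by simp
      finally have "norm2 P m1 m2 (global_error P v m1 m2 dt V n)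
          \<le> C * (dt\<^sup>2 + (dx P m1)\<^sup>2 + (dy P m2)\<^sup>2)"
        by (intro error adm h(3) cn n)
      also have "\<dots> < C * (3 * d)"
        using sq[OF h(3,4)] sq[OF dx_pos h(1)] sq[OF dy_pos h(2)] \<open>0 < C\<close>
        by (intro mult_strict_left_mono) auto
      also have "\<dots> \<le> \<epsilon>"
        using d(4) \<open>0 < C\<close> by (simp add: field_simps)
      finally show "norm2 P m1 m2 (global_error P v m1 m2 dt V n) < \<epsilon>" .
    qed
  qed
  with error \<open>0 < C\<close> show ?thesis by blast
qed

end
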